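(* Let $\Psi\in\Omega^{2l-1}(M,TM)$ be a square-zero element of odd degree on a smooth manifold $M$, let $L$ be a closed $\Psi$-submanifold, and use a tubular neighborhood to regard $\Psi$ as an element of $\Omega^*(NL,TNL)$. The formal $\Psi$-deformations of $L$ are governed by the $L_\infty$-algebra $\Omega^*(L,NL)[-1]$ associated with $L$. Namely, a formal deformation $s(\varepsilon)$ of $L$ is a formal $\Psi$-deformation if and only if $-s(\varepsilon)$ is a solution of the (formal) Maurer–Cartan equation, i.e. $MC(-s(\varepsilon))=0$, where $$MC(x(\varepsilon)):=\sum_{n=1}^\infty\frac1{n!}\,\mathfrak{l}_n(x(\varepsilon),\dots,x(\varepsilon)).$$
   Context: $[-,-]^{FN}$ is the Frölicher–Nijenhuis bracket on $TM$-valued forms $\Omega^*(M,TM)$; $\Psi$ of odd degree is square-zero if $[\Psi,\Psi]^{FN}=0$. A submanifold $L$ with $\dim L\ge\deg\Psi$ is a $\Psi$-submanifold if $\Psi_{|L}$ takes values in $TL$. $NL=TM_{|L}/TL$. A tubular neighborhood is a diffeomorphism $\tau:NL\to U$ onto an open neighborhood of $L$ in $M$ restricting to the inclusion of $L$ on the zero section; it is used to replace $M$ by $NL$. Closed means compact without boundary. $\mathrm j_L:\Omega^*(L,NL)\to\Omega^*(NL,TNL)$ is $\mathrm j_L(\omega\otimes X)=\pi^*\omega\otimes\hat X$, with $\pi:NL\to L$ and $\hat X$ the fibrewise constant vertical vector field defined by $X\in\Gamma(NL)$. $P_L:\Omega^*(NL,TNL)\to\Omega^*(L,NL)$ is restriction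 to the zero section followed by the projection $TNL_{|L}=TL\oplus NL\to NL$. The $\mathbb Z_2$-graded $L_\infty$-algebra $\Omega^*(L,NL)[-1]$ has brackets $$\mathfrak l_n(a_1,\dots,a_n)=(-1)^\star P_L[\cdots[[\Psi,\mathrm j_L(a_1)]^{FN},\mathrm j_L(a_2)]^{FN},\dots,\mathrm j_L(a_n)]^{FN},\quad\star=(n-1)|a_1|+(n-2)|a_2|+\cdots+|a_{n-1}|+\tfrac{n(n+1)}2,$$ where $|\cdot|$ is the degree in $\Omega^*(L,NL)[-1]$ (so elements of $\Omega^0(L,NL)=\Gamma(NL)$ have degree $1$). The brackets, $\mathrm j_L$ and $P_L$ are extended $\varepsilon$-linearly to formal power series. A formal deformation of $L$ is a series $s(\varepsilon)=\sum_{i\ge0}\varepsilon^is_i\in\Gamma(NL)[[\varepsilon]]$ with $s_0=0$. It is a formal $\Psi$-deformation if $P_L(\exp\mathcal L_{\mathrm j_L(-s(\varepsilon))}\Psi)=0\in\Omega^*(L,NL)[[\varepsilon]]$, where $\mathcal L_{\xi(\varepsilon)}T=\sum_k\varepsilon^k\sum_{i+j=k}\mathcal L_{\xi_i}T_j$ is the formal Lie derivative and $\exp\mathcal L_{\xi(\varepsilon)}=\sum_{n\ge0}\frac1{n!}\mathcal L^n_{\xi(\varepsilon)}$. *)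

theory Defs
  imports "HOL-Analysis.Analysis" "HOL-Combinatorics.Permutations"
begin

section \<open>Smooth maps between open subsets of Euclidean spaces\<close>

text \<open>
  Only used for open \<open>S\<close>.  In finite dimension, a map is of class $C^{k+1}$ iff it is
  differentiable and all its directional derivatives are of class $C^k$.
\<close>

primrec Ck :: "nat \<Rightarrow> 'a::euclidean_space set \<Rightarrow> ('a \<Rightarrow> 'b::euclidean_space) \<Rightarrow> bool" where
  "Ck 0 S f \<longleftrightarrow> continuous_on S f"
| "Ck (Suc k) S f \<longleftrightarrow>
     (\<forall>x\<in>S. f differentiable (at x)) \<and> (\<forall>v. Ck k S (\<lambda>x. frechet_derivative f (at x) v))"

definition smooth_on :: "'a::euclidean_space set \<Rightarrow> ('a \<Rightarrow> 'b::euclidean_space) \<Rightarrow> bool" where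
  "smooth_on S f \<longleftrightarrow> open S \<and> (\<forall>k. Ck k S f)"


section \<open>Charts, atlases, manifolds\<close>

text \<open>
  A chart is a pair of its domain and its coordinate map.  Coordinates live in a Euclidean space
  \<open>'e\<close>, so that \<open>DIM('e)\<close> is the dimension of the manifold.  The point set of the manifold
  presented by an atlas is the union of the chart domains.
\<close>

type_synonym ('a, 'e) chart = "'a set \<times> ('a \<Rightarrow> 'e)"

definition chart_inv :: "('a, 'e) chart \<Rightarrow> 'e \<Rightarrow> 'a" where
  "chart_inv c = inv_into (fst c) (snd c)"

definition chart_image :: "('a, 'e) chart \<Rightarrow> 'e set" where
  "chart_image c = snd c ` fst c"

definition points :: "('a, 'e) chart set \<Rightarrow> 'a set" where
  "points A = \<Union> (fst ` A)"

definition is_chart :: "('a, 'e::euclidean_space) chart \<Rightarrow> bool" where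
  "is_chart c \<longleftrightarrow> inj_on (snd c) (fst c) \<and> open (chart_image c)"

definition compatible :: "('a, 'e::euclidean_space) chart \<Rightarrow> ('a, 'e) chart \<Rightarrow> bool" where
  "compatible c d \<longleftrightarrow>
     smooth_on (snd c ` (fst c \<inter> fst d)) (\<lambda>x. snd d (chart_inv c x)) \<and>
     smooth_on (snd d ` (fst c \<inter> fst d)) (\<lambda>x. snd c (chart_inv d x))"

definition smooth_atlas :: "('a, 'e::euclidean_space) chart set \<Rightarrow> bool" where
  "smooth_atlas A \<longleftrightarrow> (\<forall>c\<in>A. is_chart c) \<and> (\<forall>c\<in>A. \<forall>d\<in>A. compatible c d)"

text \<open>The maximal atlas determined by \<open>A\<close>.\<close>

definition charts :: "('a, 'e::euclidean_space) chart set \<Rightarrow> ('a, 'e) chart set" where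
  "charts A = {c. is_chart c \<and> fst c \<subseteq> points A \<and> (\<forall>a\<in>A. compatible c a)}"

definition charts_at :: "('a, 'e::euclidean_space) chart set \<Rightarrow> 'a \<Rightarrow> ('a, 'e) chart set" where
  "charts_at A p = {c \<in> charts A. p \<in> fst c}"

definition smooth_manifold ::
  "('m::{t2_space, second_countable_topology}, 'e::euclidean_space) chart set \<Rightarrow> bool" where
  "smooth_manifold A \<longleftrightarrow>
     smooth_atlas A \<and> points A = UNIV \<and>
     (\<forall>c\<in>A. open (fst c) \<and> homeomorphism (fst c) (chart_image c) (snd c) (chart_inv c))"

definition smooth_map ::
  "('a, 'e::euclidean_space) chart set \<Rightarrow> ('b, 'f::euclidean_space) chart set \<Rightarrow> ('a \<Rightarrow> 'b) \<Rightarrow> bool" where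
  "smooth_map A B f \<longleftrightarrow>
     f ` points A \<subseteq> points B \<and>
     (\<forall>c\<in>charts A. \<forall>d\<in>charts B.
        smooth_on (snd c ` {p \<in> fst c. f p \<in> fst d}) (\<lambda>x. snd d (f (chart_inv c x))))"

definition diffeomorphism ::
  "('a, 'e::euclidean_space) chart set \<Rightarrow> ('b, 'f::euclidean_space) chart set \<Rightarrow> ('a \<Rightarrow> 'b) \<Rightarrow> bool" where
  "diffeomorphism A B f \<longleftrightarrow>
     bij_betw f (points A) (points B) \<and> smooth_map A B f \<and> smooth_map B A (inv_into (points A) f)"

definition open_submanifold :: "('a, 'e::euclidean_space) chart set \<Rightarrow> 'a set \<Rightarrow> ('a, 'e) chart set" where
  "open_submanifold A U = {c \<in> charts A. fst c \<subseteq> U}"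


section \<open>Tangent spaces\<close>

text \<open>
  A tangent vector at \<open>p\<close> is a family of coordinate vectors, one for each chart of the maximal
  atlas around \<open>p\<close>, which transforms by the derivatives of the transition maps.  Vector space
  operations are pointwise.
\<close>

type_synonym ('a, 'e) tvec = "('a, 'e) chart \<Rightarrow> 'e"

definition tspace :: "('a, 'e::euclidean_space) chart set \<Rightarrow> 'a \<Rightarrow> ('a, 'e) tvec set" where
  "tspace A p = {v.
     (\<forall>c\<in>charts_at A p. \<forall>d\<in>charts_at A p.
        v d = frechet_derivative (\<lambda>x. snd d (chart_inv c x)) (at (snd c p)) (v c)) \<and>
     (\<forall>c. c \<notin> charts_at A p \<longrightarrow> v c = 0)}"

text \<open>The tangent vector at \<open>p\<close> with coordinates \<open>u\<close> in the chart \<open>c\<close>.\<close>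

definition tvec_of ::
  "('a, 'e::euclidean_space) chart set \<Rightarrow> ('a, 'e) chart \<Rightarrow> 'a \<Rightarrow> 'e \<Rightarrow> ('a, 'e) tvec" where
  "tvec_of A c p u = (\<lambda>d. if d \<in> charts_at A p
     then frechet_derivative (\<lambda>x. snd d (chart_inv c x)) (at (snd c p)) u else 0)"

text \<open>
  The differential of \<open>f\<close> at \<open>p\<close>; by the chain rule it does not depend on the chart chosen
  around \<open>p\<close>.
\<close>

definition dmap ::
  "('a, 'e::euclidean_space) chart set \<Rightarrow> ('b, 'f::euclidean_space) chart set \<Rightarrow> ('a \<Rightarrow> 'b) \<Rightarrow>
   'a \<Rightarrow> ('a, 'e) tvec \<Rightarrow> ('b, 'f) tvec" where
  "dmap A B f p v = (let c = (SOME c. c \<in> charts_at A p) in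
     (\<lambda>d. if d \<in> charts_at B (f p)
        then frechet_derivative (\<lambda>x. snd d (f (chart_inv c x))) (at (snd c p)) (v c) else 0))"

text \<open>The velocity at time 0 of a curve.\<close>

definition velocity :: "('a, 'e::euclidean_space) chart set \<Rightarrow> (real \<Rightarrow> 'a) \<Rightarrow> ('a, 'e) tvec" where
  "velocity A \<gamma> = (\<lambda>c. if c \<in> charts_at A (\<gamma> 0)
     then vector_derivative (\<lambda>t. snd c (\<gamma> t)) (at 0) else 0)"


section \<open>Tangent-valued forms\<close>

text \<open>
  A form assigns to a point and to a list of vectors a vector.  Its values on anything but lists
  of tangent vectors of the right length are irrelevant.  Vector fields are forms of degree 0.
\<close>

type_synonym ('a, 'e) form = "'a \<Rightarrow> ('a, 'e) tvec list \<Rightarrow> ('a, 'e) tvec"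

definition alternating_multilinear ::
  "nat \<Rightarrow> ('i \<Rightarrow> 'e::real_vector) set \<Rightarrow> ('i \<Rightarrow> 'e) set \<Rightarrow> (('i \<Rightarrow> 'e) list \<Rightarrow> ('i \<Rightarrow> 'e)) \<Rightarrow> bool" where
  "alternating_multilinear k S T K \<longleftrightarrow>
     (\<forall>vs. length vs = k \<and> set vs \<subseteq> S \<longrightarrow>
        K vs \<in> T \<and>
        (\<forall>i<k. \<forall>v\<in>S. \<forall>w\<in>S. \<forall>r.
           K (vs[i := (\<lambda>c. r *\<^sub>R v c + w c)]) = (\<lambda>c. r *\<^sub>R K (vs[i := v]) c + K (vs[i := w]) c)) \<and>
        (\<forall>j<k. \<forall>i<j. vs ! i = vs ! j \<longrightarrow> K vs = (\<lambda>_. 0)))"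

text \<open>The coordinate expression of a form in a chart.\<close>

definition loc ::
  "('a, 'e::euclidean_space) chart set \<Rightarrow> ('a, 'e) form \<Rightarrow> ('a, 'e) chart \<Rightarrow> 'e \<Rightarrow> 'e list \<Rightarrow> 'e" where
  "loc A K c = (\<lambda>x us. K (chart_inv c x) (map (tvec_of A c (chart_inv c x)) us) c)"

text \<open>$\Omega^k(M,TM)$ for the manifold $M$ with atlas \<open>A\<close>.\<close>

definition tforms :: "('a, 'e::euclidean_space) chart set \<Rightarrow> nat \<Rightarrow> ('a, 'e) form set" where
  "tforms A k = {K.
     (\<forall>p\<in>points A. alternating_multilinear k (tspace A p) (tspace A p) (K p)) \<and>
     (\<forall>c\<in>charts A. \<forall>us. length us = k \<longrightarrow> smooth_on (chart_image c) (\<lambda>x. loc A K c x us))}"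

definition tform_zero :: "('a, 'e::euclidean_space) chart set \<Rightarrow> nat \<Rightarrow> ('a, 'e) form \<Rightarrow> bool" where
  "tform_zero A k K \<longleftrightarrow>
     (\<forall>p\<in>points A. \<forall>vs. length vs = k \<and> set vs \<subseteq> tspace A p \<longrightarrow> K p vs = (\<lambda>_. 0))"

text \<open>
  The pullback along a local diffeomorphism \<open>f\<close>:
  $(f^*K)_q(w_1,\dots,w_k) = (df_q)^{-1}\, K_{f(q)}(df_q w_1,\dots,df_q w_k)$.
\<close>

definition pullback ::
  "('b, 'f::euclidean_space) chart set \<Rightarrow> ('a, 'e::euclidean_space) chart set \<Rightarrow> ('b \<Rightarrow> 'a) \<Rightarrow>
   ('a, 'e) form \<Rightarrow> ('b, 'f) form" where
  "pullback N A f K = (\<lambda>q ws.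
     inv_into (tspace N q) (dmap N A f q) (K (f q) (map (dmap N A f q) ws)))"


section \<open>Frolicher-Nijenhuis bracket and Lie derivative\<close>

definition lie :: "('e::euclidean_space \<Rightarrow> 'e) \<Rightarrow> ('e \<Rightarrow> 'e) \<Rightarrow> 'e \<Rightarrow> 'e" where
  "lie X Y = (\<lambda>x. frechet_derivative Y (at x) (X x) - frechet_derivative X (at x) (Y x))"

definition on_fields :: "('e \<Rightarrow> 'e list \<Rightarrow> 'e) \<Rightarrow> ('e \<Rightarrow> 'e) list \<Rightarrow> 'e \<Rightarrow> 'e" where
  "on_fields K Xs = (\<lambda>x. K x (map (\<lambda>X. X x) Xs))"

text \<open>
  The global formula for the bracket of a \<open>k\<close>-form \<open>K\<close> and an \<open>l\<close>-form \<open>L\<close>, evaluated on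
  \<open>k + l\<close> vector fields (Kolar, Michor, Slovak, Natural Operations in Differential Geometry, 8.9):
  \[\begin{array}{l}
    \frac{1}{k!\,l!} \sum_\sigma \mathrm{sgn}\,\sigma\,
       [K(X_{\sigma 1},\dots,X_{\sigma k}), L(X_{\sigma(k+1)},\dots)] \cr
    {} - \frac{1}{k!\,(l-1)!} \sum_\sigma \mathrm{sgn}\,\sigma\,
       L([K(X_{\sigma 1},\dots,X_{\sigma k}), X_{\sigma(k+1)}], X_{\sigma(k+2)},\dots) \cr
    {} + \frac{(-1)^{kl}}{(k-1)!\,l!} \sum_\sigma \mathrm{sgn}\,\sigma\,
       K([L(X_{\sigma 1},\dots,X_{\sigma l}), X_{\sigma(l+1)}], X_{\sigma(l+2)},\dots) \cr
    {} + \frac{(-1)^{k-1}}{(k-1)!\,(l-1)!\,2!} \sum_\sigma \mathrm{sgn}\,\sigma\,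
       L(K([X_{\sigma 1},X_{\sigma 2}],X_{\sigma 3},\dots),X_{\sigma(k+2)},\dots) \cr
    {} + \frac{(-1)^{(k-1)l}}{(k-1)!\,(l-1)!\,2!} \sum_\sigma \mathrm{sgn}\,\sigma\,
       K(L([X_{\sigma 1},X_{\sigma 2}],X_{\sigma 3},\dots),X_{\sigma(l+2)},\dots)
  \end{array}\]
  where terms involving $(-1)!$ are absent.
\<close>

definition fn_on_fields ::
  "nat \<Rightarrow> nat \<Rightarrow> ('e::euclidean_space \<Rightarrow> 'e list \<Rightarrow> 'e) \<Rightarrow> ('e \<Rightarrow> 'e list \<Rightarrow> 'e) \<Rightarrow>
   ('e \<Rightarrow> 'e) list \<Rightarrow> 'e \<Rightarrow> 'e" where
  "fn_on_fields k l K L Xs x =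
    (let S = {\<sigma>. \<sigma> permutes {..<k + l}};
         sg = (\<lambda>\<sigma>. real_of_int (sign \<sigma>));
         Y = (\<lambda>\<sigma>. map (\<lambda>i. Xs ! \<sigma> i) [0..<k + l])
     in
       (1 / (fact k * fact l)) *\<^sub>R
         (\<Sum>\<sigma>\<in>S. sg \<sigma> *\<^sub>R lie (on_fields K (take k (Y \<sigma>))) (on_fields L (drop k (Y \<sigma>))) x)
     - (if l = 0 then 0 else (1 / (fact k * fact (l - 1))) *\<^sub>R
         (\<Sum>\<sigma>\<in>S. sg \<sigma> *\<^sub>R
            on_fields L (lie (on_fields K (take k (Y \<sigma>))) (Y \<sigma> ! k) # drop (k + 1) (Y \<sigma>)) x))
     + (if k = 0 then 0 else ((-1) ^ (k * l) / (fact (k - 1) * fact l)) *\<^sub>R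
         (\<Sum>\<sigma>\<in>S. sg \<sigma> *\<^sub>R
            on_fields K (lie (on_fields L (take l (Y \<sigma>))) (Y \<sigma> ! l) # drop (l + 1) (Y \<sigma>)) x))
     + (if k = 0 \<or> l = 0 then 0 else ((-1) ^ (k - 1) / (fact (k - 1) * fact (l - 1) * 2)) *\<^sub>R
         (\<Sum>\<sigma>\<in>S. sg \<sigma> *\<^sub>R
            on_fields L (on_fields K (lie (Y \<sigma> ! 0) (Y \<sigma> ! 1) # take (k - 1) (drop 2 (Y \<sigma>)))
              # drop (k + 1) (Y \<sigma>)) x))
     + (if k = 0 \<or> l = 0 then 0 else ((-1) ^ ((k - 1) * l) / (fact (k - 1) * fact (l - 1) * 2)) *\<^sub>R
         (\<Sum>\<sigma>\<in>S. sg \<sigma> *\<^sub>R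
            on_fields K (on_fields L (lie (Y \<sigma> ! 0) (Y \<sigma> ! 1) # take (l - 1) (drop 2 (Y \<sigma>)))
              # drop (l + 1) (Y \<sigma>)) x)))"

text \<open>
  The bracket is tensorial and natural, so its coordinates in a chart are obtained from
  the coordinate expressions of \<open>K\<close> and \<open>L\<close>, extending the arguments to vector
  fields that are constant in the chart.
\<close>

definition fn_bracket ::
  "('a, 'e::euclidean_space) chart set \<Rightarrow> nat \<Rightarrow> nat \<Rightarrow> ('a, 'e) form \<Rightarrow> ('a, 'e) form \<Rightarrow> ('a, 'e) form" where
  "fn_bracket A k l K L = (\<lambda>p vs c. if c \<in> charts_at A p
     then fn_on_fields k l (loc A K c) (loc A L c) (map (\<lambda>v _. v c) vs) (snd c p) else 0)"

text \<open>
  The Lie derivative along a vector field \<open>\<xi>\<close>: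
  $(\mathcal L_\xi T)(X_1,\dots,X_k) =
   [\xi, T(X_1,\dots,X_k)] - \sum_i T(X_1,\dots,[\xi,X_i],\dots,X_k)$.
\<close>

definition lie_deriv_on_fields ::
  "('e::euclidean_space \<Rightarrow> 'e) \<Rightarrow> ('e \<Rightarrow> 'e list \<Rightarrow> 'e) \<Rightarrow> ('e \<Rightarrow> 'e) list \<Rightarrow> 'e \<Rightarrow> 'e" where
  "lie_deriv_on_fields \<xi> T Xs x =
     lie \<xi> (on_fields T Xs) x - (\<Sum>i<length Xs. on_fields T (Xs[i := lie \<xi> (Xs ! i)]) x)"

definition lie_deriv ::
  "('a, 'e::euclidean_space) chart set \<Rightarrow> ('a, 'e) form \<Rightarrow> ('a, 'e) form \<Rightarrow> ('a, 'e) form" where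
  "lie_deriv A \<xi> T = (\<lambda>p vs c. if c \<in> charts_at A p
     then lie_deriv_on_fields (\<lambda>x. loc A \<xi> c x []) (loc A T c) (map (\<lambda>v _. v c) vs) (snd c p) else 0)"

definition square_zero :: "('a, 'e::euclidean_space) chart set \<Rightarrow> nat \<Rightarrow> ('a, 'e) form \<Rightarrow> bool" where
  "square_zero A k \<Psi> \<longleftrightarrow> tform_zero A (k + k) (fn_bracket A k k \<Psi> \<Psi>)"


section \<open>Submanifolds and their normal bundles\<close>

text \<open>
  A submanifold of dimension $d$ is locally given by the vanishing of the coordinates outside a
  fixed set \<open>B\<close> of $d$ basis vectors, so \<open>B \<subseteq> Basis\<close> encodes the inclusion of
  $\mathbb R^d$ into \<open>'e\<close> and the dimension is \<open>card B\<close>.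
\<close>

definition tpart :: "'e::euclidean_space set \<Rightarrow> 'e \<Rightarrow> 'e" where
  "tpart B x = (\<Sum>b\<in>B. (x \<bullet> b) *\<^sub>R b)"

definition npart :: "'e::euclidean_space set \<Rightarrow> 'e \<Rightarrow> 'e" where
  "npart B x = (\<Sum>b\<in>Basis - B. (x \<bullet> b) *\<^sub>R b)"

definition slice_charts ::
  "('a, 'e::euclidean_space) chart set \<Rightarrow> 'e set \<Rightarrow> 'a set \<Rightarrow> ('a, 'e) chart set" where
  "slice_charts A B L = {c \<in> charts A. snd c ` (fst c \<inter> L) = {x \<in> chart_image c. npart B x = 0}}"

definition slice_charts_at ::
  "('a, 'e::euclidean_space) chart set \<Rightarrow> 'e set \<Rightarrow> 'a set \<Rightarrow> 'a \<Rightarrow> ('a, 'e) chart set" where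
  "slice_charts_at A B L p = {c \<in> slice_charts A B L. p \<in> fst c}"

definition submanifold :: "('a, 'e::euclidean_space) chart set \<Rightarrow> 'e set \<Rightarrow> 'a set \<Rightarrow> bool" where
  "submanifold A B L \<longleftrightarrow> (\<forall>p\<in>L. slice_charts_at A B L p \<noteq> {})"

text \<open>$T_pL$ as a subspace of $T_pM$.\<close>

definition tsub :: "('a, 'e::euclidean_space) chart set \<Rightarrow> 'e set \<Rightarrow> 'a set \<Rightarrow> 'a \<Rightarrow> ('a, 'e) tvec set" where
  "tsub A B L p = {v \<in> tspace A p. \<forall>c\<in>slice_charts_at A B L p. npart B (v c) = 0}"

text \<open>
  The quotient $N_pL = T_pM/T_pL$, realized as the image of a linear map \<open>nproj\<close> on $T_pM$
  with kernel $T_pL$: the normal coordinates in all slice charts.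
\<close>

definition nproj ::
  "('a, 'e::euclidean_space) chart set \<Rightarrow> 'e set \<Rightarrow> 'a set \<Rightarrow> 'a \<Rightarrow> ('a, 'e) tvec \<Rightarrow> ('a, 'e) tvec" where
  "nproj A B L p v = (\<lambda>c. if c \<in> slice_charts_at A B L p then npart B (v c) else 0)"

lemma nproj_linear:
  "nproj A B L p (\<lambda>c. r *\<^sub>R v c + w c) = (\<lambda>c. r *\<^sub>R nproj A B L p v c + nproj A B L p w c)"
  by (auto simp: nproj_def npart_def inner_left_distrib algebra_simps sum.distrib scaleR_sum_right)

lemma nproj_kernel: "{v \<in> tspace A p. nproj A B L p v = (\<lambda>_. 0)} = tsub A B L p"
  by (auto simp: nproj_def tsub_def fun_eq_iff split: if_splits)

definition nfibre :: "('a, 'e::euclidean_space) chart set \<Rightarrow> 'e set \<Rightarrow> 'a set \<Rightarrow> 'a \<Rightarrow> ('a, 'e) tvec set" where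
  "nfibre A B L p = nproj A B L p ` tspace A p"

definition ntotal ::
  "('a, 'e::euclidean_space) chart set \<Rightarrow> 'e set \<Rightarrow> 'a set \<Rightarrow> ('a \<times> ('a, 'e) tvec) set" where
  "ntotal A B L = {(p, w). p \<in> L \<and> w \<in> nfibre A B L p}"

text \<open>
  A slice chart \<open>c\<close> trivializes $NL$.  As \<open>snd c p\<close> lies in the span of \<open>B\<close> and \<open>w c\<close> in
  its orthogonal complement, their sum encodes the pair of base and fibre coordinates.
\<close>

definition nchart ::
  "('a, 'e::euclidean_space) chart set \<Rightarrow> 'e set \<Rightarrow> 'a set \<Rightarrow> ('a, 'e) chart \<Rightarrow>
   ('a \<times> ('a, 'e) tvec, 'e) chart" where
  "nchart A B L c = ({q \<in> ntotal A B L. fst q \<in> fst c}, (\<lambda>(p, w). snd c p + w c))"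

definition natlas ::
  "('a, 'e::euclidean_space) chart set \<Rightarrow> 'e set \<Rightarrow> 'a set \<Rightarrow> ('a \<times> ('a, 'e) tvec, 'e) chart set" where
  "natlas A B L = nchart A B L ` slice_charts A B L"

definition zero_section :: "'a \<Rightarrow> 'a \<times> ('a, 'e::euclidean_space) tvec" where
  "zero_section p = (p, \<lambda>_. 0)"

definition tubular_neighborhood ::
  "('m::{t2_space, second_countable_topology}, 'e::euclidean_space) chart set \<Rightarrow> 'e set \<Rightarrow> 'm set \<Rightarrow>
   ('m \<times> ('m, 'e) tvec \<Rightarrow> 'm) \<Rightarrow> bool" where
  "tubular_neighborhood A B L \<tau> \<longleftrightarrow>
     (\<exists>U. open U \<and> L \<subseteq> U \<and> diffeomorphism (natlas A B L) (open_submanifold A U) \<tau>) \<and>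
     (\<forall>p\<in>L. \<tau> (zero_section p) = p)"

definition psi_submanifold ::
  "('a, 'e::euclidean_space) chart set \<Rightarrow> 'e set \<Rightarrow> 'a set \<Rightarrow> nat \<Rightarrow> ('a, 'e) form \<Rightarrow> bool" where
  "psi_submanifold A B L k \<Psi> \<longleftrightarrow>
     submanifold A B L \<and> k \<le> card B \<and>
     (\<forall>p\<in>L. \<forall>vs. length vs = k \<and> set vs \<subseteq> tsub A B L p \<longrightarrow> \<Psi> p vs \<in> tsub A B L p)"


section \<open>Forms on the submanifold with values in the normal bundle\<close>

text \<open>
  $\Omega^k(L,NL)$; degree 0 gives $\Gamma(NL)$.  Smoothness in the chart of $L$ induced by a slice
  chart is expressed by extending constantly in the normal directions.
\<close>

definition nforms ::
  "('a, 'e::euclidean_space) chart set \<Rightarrow> 'e set \<Rightarrow> 'a set \<Rightarrow> nat \<Rightarrow> ('a, 'e) form set" where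
  "nforms A B L k = {\<alpha>.
     (\<forall>p\<in>L. alternating_multilinear k (tsub A B L p) (nfibre A B L p) (\<alpha> p)) \<and>
     (\<forall>c\<in>slice_charts A B L. \<forall>us. length us = k \<and> (\<forall>u\<in>set us. npart B u = 0) \<longrightarrow>
        smooth_on (tpart B -` chart_image c) (\<lambda>x. loc A \<alpha> c (tpart B x) us))}"

definition nform_zero ::
  "('a, 'e::euclidean_space) chart set \<Rightarrow> 'e set \<Rightarrow> 'a set \<Rightarrow> nat \<Rightarrow> ('a, 'e) form \<Rightarrow> bool" where
  "nform_zero A B L k \<alpha> \<longleftrightarrow>
     (\<forall>p\<in>L. \<forall>vs. length vs = k \<and> set vs \<subseteq> tsub A B L p \<longrightarrow> \<alpha> p vs = (\<lambda>_. 0))"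

text \<open>
  $\mathrm j_L(\omega\otimes X) = \pi^*\omega\otimes\hat X$ with $\hat X$ the velocity of
  $t \mapsto q + t X(\pi(q))$.  Here \<open>\<pi>\<close> is \<open>fst\<close>, regarded as a map into the ambient manifold.
\<close>

definition vertical_lift ::
  "('a, 'e::euclidean_space) chart set \<Rightarrow> 'e set \<Rightarrow> 'a set \<Rightarrow> 'a \<times> ('a, 'e) tvec \<Rightarrow> ('a, 'e) tvec \<Rightarrow>
   ('a \<times> ('a, 'e) tvec, 'e) tvec" where
  "vertical_lift A B L q w = velocity (natlas A B L) (\<lambda>t. (fst q, \<lambda>c. snd q c + t *\<^sub>R w c))"

definition jL ::
  "('a, 'e::euclidean_space) chart set \<Rightarrow> 'e set \<Rightarrow> 'a set \<Rightarrow> ('a, 'e) form \<Rightarrow>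
   ('a \<times> ('a, 'e) tvec, 'e) form" where
  "jL A B L \<alpha> = (\<lambda>q ws. vertical_lift A B L q (\<alpha> (fst q) (map (dmap (natlas A B L) A fst q) ws)))"

text \<open>The differential of the zero section on $T_pL$; \<open>tpart\<close> is used as in \<open>nforms\<close>.\<close>

definition dzero ::
  "('a, 'e::euclidean_space) chart set \<Rightarrow> 'e set \<Rightarrow> 'a set \<Rightarrow> 'a \<Rightarrow> ('a, 'e) tvec \<Rightarrow>
   ('a \<times> ('a, 'e) tvec, 'e) tvec" where
  "dzero A B L p v = (let c = (SOME c. c \<in> slice_charts_at A B L p) in
     (\<lambda>d. if d \<in> charts_at (natlas A B L) (zero_section p)
        then frechet_derivative (\<lambda>x. snd d (zero_section (chart_inv c (tpart B x)))) (at (snd c p)) (v c)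
        else 0))"

text \<open>
  The projection $T_{0_p}NL = T_pL\oplus N_pL\to N_pL$.  In the chart \<open>nchart A B L c\<close>, the
  summand $T_pL$ is the span of \<open>B\<close>, and the vertical vector $w \in N_pL$ has
  coordinates \<open>w c\<close> in the orthogonal complement.
\<close>

definition normal_component ::
  "('a, 'e::euclidean_space) chart set \<Rightarrow> 'e set \<Rightarrow> 'a set \<Rightarrow> 'a \<Rightarrow>
   ('a \<times> ('a, 'e) tvec, 'e) tvec \<Rightarrow> ('a, 'e) tvec" where
  "normal_component A B L p v =
     (\<lambda>c. if c \<in> slice_charts_at A B L p then npart B (v (nchart A B L c)) else 0)"

definition PL ::
  "('a, 'e::euclidean_space) chart set \<Rightarrow> 'e set \<Rightarrow> 'a set \<Rightarrow> ('a \<times> ('a, 'e) tvec, 'e) form \<Rightarrow>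
   ('a, 'e) form" where
  "PL A B L K = (\<lambda>p vs. normal_component A B L p (K (zero_section p) (map (dzero A B L p) vs)))"


section \<open>The brackets\<close>

text \<open>
  The arguments of a bracket are homogeneous forms paired with their degree in $\Omega^*(L,NL)$;
  the degree in $\Omega^*(L,NL)[-1]$ is larger by one.
\<close>

primrec iterated_bracket ::
  "('a, 'e::euclidean_space) chart set \<Rightarrow> 'e set \<Rightarrow> 'a set \<Rightarrow> (nat \<times> ('a, 'e) form) list \<Rightarrow>
   nat \<Rightarrow> ('a \<times> ('a, 'e) tvec, 'e) form \<Rightarrow> ('a \<times> ('a, 'e) tvec, 'e) form" where
  "iterated_bracket A B L [] k K = K"
| "iterated_bracket A B L (a # as) k K =
     iterated_bracket A B L as (k + fst a) (fn_bracket (natlas A B L) k (fst a) K (jL A B L (snd a)))"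

definition star_sign :: "nat list \<Rightarrow> nat" where
  "star_sign ds = (let n = length ds in (\<Sum>i<n. (n - 1 - i) * (ds ! i + 1)) + n * (n + 1) div 2)"

definition lbracket ::
  "('a, 'e::euclidean_space) chart set \<Rightarrow> 'e set \<Rightarrow> 'a set \<Rightarrow> nat \<Rightarrow> ('a \<times> ('a, 'e) tvec, 'e) form \<Rightarrow>
   (nat \<times> ('a, 'e) form) list \<Rightarrow> ('a, 'e) form" where
  "lbracket A B L k \<Psi> as =
     (\<lambda>p vs c. (-1) ^ star_sign (map fst as) *\<^sub>R PL A B L (iterated_bracket A B L as k \<Psi>) p vs c)"


section \<open>Formal power series\<close>

text \<open>
  A formal power series is its sequence of coefficients.  Infinite sums of series are taken
  coefficientwise; if the vector field has no term of order 0, only finitely many summands contribute to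
  each coefficient of the exponential and of the Maurer-Cartan expression.
\<close>

definition lbracket_series ::
  "('a, 'e::euclidean_space) chart set \<Rightarrow> 'e set \<Rightarrow> 'a set \<Rightarrow> nat \<Rightarrow> ('a \<times> ('a, 'e) tvec, 'e) form \<Rightarrow>
   (nat \<times> (nat \<Rightarrow> ('a, 'e) form)) list \<Rightarrow> nat \<Rightarrow> ('a, 'e) form" where
  "lbracket_series A B L k \<Psi> as m =
     (\<lambda>p vs c. \<Sum>js\<in>{js. length js = length as \<and> sum_list js = m}.
        lbracket A B L k \<Psi> (map2 (\<lambda>a j. (fst a, snd a j)) as js) p vs c)"

definition neg_series :: "(nat \<Rightarrow> ('a, 'e::euclidean_space) form) \<Rightarrow> nat \<Rightarrow> ('a, 'e) form" where
  "neg_series s = (\<lambda>i p vs c. - s i p vs c)"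

definition const_series :: "('a, 'e::euclidean_space) form \<Rightarrow> nat \<Rightarrow> ('a, 'e) form" where
  "const_series T = (\<lambda>m p vs c. if m = 0 then T p vs c else 0)"

definition lie_series ::
  "('a, 'e::euclidean_space) chart set \<Rightarrow> (nat \<Rightarrow> ('a, 'e) form) \<Rightarrow> (nat \<Rightarrow> ('a, 'e) form) \<Rightarrow>
   nat \<Rightarrow> ('a, 'e) form" where
  "lie_series A \<xi> T = (\<lambda>m p vs c. \<Sum>i\<le>m. lie_deriv A (\<xi> i) (T (m - i)) p vs c)"

definition exp_lie_series ::
  "('a, 'e::euclidean_space) chart set \<Rightarrow> (nat \<Rightarrow> ('a, 'e) form) \<Rightarrow> (nat \<Rightarrow> ('a, 'e) form) \<Rightarrow>
   nat \<Rightarrow> ('a, 'e) form" where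
  "exp_lie_series A \<xi> T = (\<lambda>m p vs c. \<Sum>n. (1 / fact n) *\<^sub>R (lie_series A \<xi> ^^ n) T m p vs c)"

definition formal_deformation ::
  "('a, 'e::euclidean_space) chart set \<Rightarrow> 'e set \<Rightarrow> 'a set \<Rightarrow> (nat \<Rightarrow> ('a, 'e) form) \<Rightarrow> bool" where
  "formal_deformation A B L s \<longleftrightarrow> (\<forall>i. s i \<in> nforms A B L 0) \<and> nform_zero A B L 0 (s 0)"

text \<open>Here and below, \<open>\<Psi>\<close> is a form of degree \<open>k\<close> on the total space of the normal bundle.\<close>

definition formal_psi_deformation ::
  "('a, 'e::euclidean_space) chart set \<Rightarrow> 'e set \<Rightarrow> 'a set \<Rightarrow> nat \<Rightarrow> ('a \<times> ('a, 'e) tvec, 'e) form \<Rightarrow>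
   (nat \<Rightarrow> ('a, 'e) form) \<Rightarrow> bool" where
  "formal_psi_deformation A B L k \<Psi> s \<longleftrightarrow>
     formal_deformation A B L s \<and>
     (\<forall>m. nform_zero A B L k
        (PL A B L (exp_lie_series (natlas A B L) (\<lambda>i. jL A B L (neg_series s i)) (const_series \<Psi>) m)))"

definition MC ::
  "('a, 'e::euclidean_space) chart set \<Rightarrow> 'e set \<Rightarrow> 'a set \<Rightarrow> nat \<Rightarrow> ('a \<times> ('a, 'e) tvec, 'e) form \<Rightarrow>
   (nat \<Rightarrow> ('a, 'e) form) \<Rightarrow> nat \<Rightarrow> ('a, 'e) form" where
  "MC A B L k \<Psi> x m = (\<lambda>p vs c.
     \<Sum>n. (1 / fact (Suc n)) *\<^sub>R lbracket_series A B L k \<Psi> (replicate (Suc n) (0, x)) m p vs c)"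

end

theory Submission
  imports Defs
begin

text \<open>
  Write \<open>\<xi>\<close> for the formal vertical vector field $\mathrm j_L(-s(\varepsilon))$.  Bracketing with a
  vector field is the Lie derivative up to sign, $[K,X]^{FN} = -\mathcal L_X K$.  The elements of
  $\Gamma(NL)$ have degree 1, so the sign exponent of $\mathfrak l_n$ on $n$ copies of $-s$ is
  $n(n-1)/2 + n(n+1)/2 = n^2$, and $(-1)^{n^2} = (-1)^n$ cancels the $n$ signs of the brackets:
  \[ \mathfrak l_n(-s,\dots,-s) = P_L(\mathcal L_\xi^n \Psi). \]
  Hence the Maurer-Cartan series is the exponential series $P_L(\exp\mathcal L_\xi \Psi)$ without
  its term $P_L(\Psi)$.  That term vanishes, because on the zero section \<open>\<Psi>\<close> maps lists of
  vectors tangent to $L$ to vectors tangent to $L$, and $P_L$ kills the latter.  So the two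
  series agree, and one vanishes iff the other does (\<open>MC_eq_PL_exp\<close>).

  Three points need work beyond this computation.

  First, brackets and Lie derivatives are given by derivatives of coordinate expressions, so
  \<open>\<Psi>\<close> and all its iterated Lie derivatives have to be smooth and alternating in coordinates.
  Evaluating at a point in a given chart uses the coordinate expressions in that chart alone
  (\<open>loc_at_point\<close>, \<open>loc_fn_bracket\<close>, \<open>loc_lie_deriv\<close>); the chart of $NL$ given by a slice chart
  therefore suffices, and no invariance under coordinate changes is involved.  In a chart, forms
  are families of alternating maps on an open set (\<open>local_form\<close>), a class which is stable under the
  Lie derivative (\<open>local_form_lie\<close>) and on which the global formula for the bracket with a field
  collapses to the Lie derivative (\<open>fn_on_const_fields\<close>).

  Second, the pullback of \<open>\<Psi>\<close> along the tubular neighborhood has to belong to that class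
  (\<open>local_form_pullback\<close>) and its restriction to the zero section has to be the one of \<open>\<Psi>\<close>
  (\<open>PL_pullback_zero\<close>).  This requires that the charts given by slice charts form a smooth atlas
  of $NL$ (\<open>smooth_atlas_natlas\<close>).

  Third, the sums over $n$ are to be taken coefficientwise.  The coefficient of $\varepsilon^m$ of
  $\mathcal L_\xi^n\Psi$ is the sum of the iterated Lie derivatives along
  $\xi_{j_1},\dots,\xi_{j_n}$ over all $j_1+\dots+j_n=m$ (\<open>loc_lie_series_power\<close>).  For $n>m$
  some $j_i$ is 0, and $\xi_0=0$; all sums are finite.
\<close>

section \<open>Smooth maps between open sets\<close>

abbreviation D :: "('a::real_normed_vector \<Rightarrow> 'b::real_normed_vector) \<Rightarrow> 'a \<Rightarrow> 'a \<Rightarrow> 'b" where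
  "D f x \<equiv> frechet_derivative f (at x)"

lemma D_eqI: "(f has_derivative f') (at x) \<Longrightarrow> D f x v = f' v"
  using frechet_derivative_at by metis

lemma D_has: "f differentiable (at x) \<Longrightarrow> (f has_derivative D f x) (at x)"
  by (simp add: frechet_derivative_works)

lemma D_linear: "f differentiable (at x) \<Longrightarrow> linear (D f x)"
  using D_has has_derivative_linear by blast

text \<open>
  As \<open>frechet_derivative\<close> is a choice among the derivatives, and both maps have the same ones, the
  equation holds even where no derivative exists.
\<close>

lemma D_cong:
  assumes "open S" "x \<in> S" "\<And>y. y \<in> S \<Longrightarrow> f y = g y"
  shows "D f x = D g x" "f differentiable (at x) \<longleftrightarrow> g differentiable (at x)"
proof -
  have *: "(f has_derivative f') (at x) = (g has_derivative f') (at x)" for f'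
    using has_derivative_transform_within_open[OF _ assms(1,2), of f f' UNIV g]
      has_derivative_transform_within_open[OF _ assms(1,2), of g f' UNIV f] assms(3) by auto
  show "D f x = D g x" by (simp add: frechet_derivative_def *)
  show "f differentiable (at x) \<longleftrightarrow> g differentiable (at x)" by (simp add: differentiable_def *)
qed

lemma D_compose:
  assumes "f differentiable (at x)" "g differentiable (at (f x))"
  shows "D (\<lambda>y. g (f y)) x v = D g (f x) (D f x v)"
  by (rule D_eqI) (use has_derivative_compose[OF D_has[OF assms(1)] D_has[OF assms(2)]] in simp)

lemma linear_basis_expand:
  fixes f :: "'a::euclidean_space \<Rightarrow> 'b::real_vector"
  assumes "linear f"
  shows "f v = (\<Sum>b\<in>Basis. (v \<bullet> b) *\<^sub>R f b)"
proof -
  have "f v = f (\<Sum>b\<in>Basis. (v \<bullet> b) *\<^sub>R b)" by (simp add: euclidean_representation)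
  also have "\<dots> = (\<Sum>b\<in>Basis. (v \<bullet> b) *\<^sub>R f b)"
    using assms by (simp add: linear_sum linear_scale)
  finally show ?thesis .
qed

lemma Ck_cong:
  assumes "open S" "\<And>x. x \<in> S \<Longrightarrow> f x = g x" "Ck k S f"
  shows "Ck k S g"
  using assms(2,3)
proof (induction k arbitrary: f g)
  case 0
  then show ?case using continuous_on_cong[of S S f g] by simp
next
  case (Suc k)
  have "D f x = D g x" "f differentiable (at x) \<longleftrightarrow> g differentiable (at x)" if "x \<in> S" for x
    using D_cong[OF assms(1) that] Suc.prems(1) by blast+
  then show ?case using Suc.prems(2) Suc.IH[of "\<lambda>x. D f x v" "\<lambda>x. D g x v" for v] by auto
qed

lemma Ck_differentiable: "Ck (Suc k) S f \<Longrightarrow> x \<in> S \<Longrightarrow> f differentiable (at x)"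
  by simp

text \<open>
  \<open>Ck (Suc k)\<close> says nothing about continuity; it is recovered from differentiability at
  the bottom of the recursion.
\<close>

lemma Ck_Suc_imp: "Ck (Suc k) S f \<Longrightarrow> Ck k S f"
proof (induction k arbitrary: f)
  case 0
  then show ?case
    by (auto intro!: continuous_at_imp_continuous_on differentiable_imp_continuous_within)
next
  case (Suc k)
  from Suc.prems have "\<And>v. Ck (Suc k) S (\<lambda>x. D f x v)" "\<forall>x\<in>S. f differentiable (at x)" by auto
  then show ?case using Suc.IH by simp
qed

lemma Ck_const: "Ck k S (\<lambda>x. a)"
  by (induction k arbitrary: a) (auto simp: frechet_derivative_const)

lemma Ck_linear:
  fixes f :: "'a::euclidean_space \<Rightarrow> 'b::euclidean_space"
  assumes "linear f" shows "Ck k S f"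
proof -
  have d: "(f has_derivative f) (at x)" for x
    using assms by (simp add: linear_conv_bounded_linear bounded_linear_imp_has_derivative)
  then have "(\<lambda>x. D f x v) = (\<lambda>x. f v)" for v using D_eqI by blast
  then show ?thesis
    using d linear_continuous_on[of f S] assms
    by (cases k) (auto simp: Ck_const differentiable_def linear_conv_bounded_linear)
qed

lemma Ck_linear_compose:
  assumes "linear h" "open S" "Ck k S f"
  shows "Ck k S (\<lambda>x. h (f x))"
  using assms(3)
proof (induction k arbitrary: f)
  case 0
  then show ?case using assms(1)
    by (auto simp: linear_conv_bounded_linear intro: bounded_linear.continuous_on)
next
  case (Suc k)
  have bl: "bounded_linear h" using assms(1) by (simp add: linear_conv_bounded_linear)
  have *: "((\<lambda>y. h (f y)) has_derivative (\<lambda>v. h (D f x v))) (at x)" if "x \<in> S" for x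
    by (intro bounded_linear.has_derivative[OF bl] D_has Ck_differentiable[OF Suc.prems that])
  have "Ck k S (\<lambda>x. D (\<lambda>y. h (f y)) x v)" for v
    by (rule Ck_cong[OF assms(2), of "\<lambda>x. h (D f x v)"])
      (use D_eqI[OF *] Suc in auto)
  then show ?case using * by (auto simp: differentiable_def)
qed

lemma Ck_add:
  assumes "open S" "Ck k S f" "Ck k S g"
  shows "Ck k S (\<lambda>x. f x + g x)"
  using assms(2,3)
proof (induction k arbitrary: f g)
  case 0
  then show ?case by (auto intro: continuous_on_add)
next
  case (Suc k)
  have *: "((\<lambda>y. f y + g y) has_derivative (\<lambda>v. D f x v + D g x v)) (at x)" if "x \<in> S" for x
    using Ck_differentiable[OF Suc.prems(1) that] Ck_differentiable[OF Suc.prems(2) that]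
    by (intro has_derivative_add D_has)
  have "Ck k S (\<lambda>x. D (\<lambda>y. f y + g y) x v)" for v
    by (rule Ck_cong[OF assms(1), of "\<lambda>x. D f x v + D g x v"])
      (use D_eqI[OF *] Suc in auto)
  then show ?case using * by (auto simp: differentiable_def)
qed

lemma Ck_sum:
  assumes "open S" "\<And>i. i \<in> I \<Longrightarrow> Ck k S (f i)"
  shows "Ck k S (\<lambda>x. \<Sum>i\<in>I. f i x)"
  using assms(2)
  by (induction I rule: infinite_finite_induct) (auto intro: Ck_const Ck_add[OF assms(1)])

lemma Ck_scaleR:
  fixes f :: "'a::euclidean_space \<Rightarrow> real"
  assumes "open S" "Ck k S f" "Ck k S g"
  shows "Ck k S (\<lambda>x. f x *\<^sub>R g x)"
  using assms(2,3)
proof (induction k arbitrary: f g)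
  case 0
  then show ?case by (auto intro: continuous_on_scaleR)
next
  case (Suc k)
  have *: "((\<lambda>y. f y *\<^sub>R g y) has_derivative (\<lambda>v. f x *\<^sub>R D g x v + D f x v *\<^sub>R g x)) (at x)"
    if "x \<in> S" for x
    using Ck_differentiable[OF Suc.prems(1) that] Ck_differentiable[OF Suc.prems(2) that]
    by (intro has_derivative_scaleR D_has)
  have "Ck k S (\<lambda>x. f x *\<^sub>R D g x v + D f x v *\<^sub>R g x)" for v
    using Suc.prems Suc.IH Ck_Suc_imp[of k S f] Ck_Suc_imp[of k S g] by (intro Ck_add[OF assms(1)]) auto
  then have "Ck k S (\<lambda>x. D (\<lambda>y. f y *\<^sub>R g y) x v)" for v
    by (rule Ck_cong[OF assms(1), rotated]) (use D_eqI[OF *] in auto)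
  then show ?case using * by (auto simp: differentiable_def)
qed

text \<open>
  By the chain rule, a directional derivative of \<open>g \<circ> f\<close> is a sum of products of components of a
  derivative of \<open>f\<close> with a partial derivative of \<open>g\<close> composed with \<open>f\<close>; to the latter the induction
  hypothesis applies, which is why \<open>g\<close> has to vary in the induction.
\<close>

lemma Ck_compose:
  assumes "open S" "open T" "\<And>x. x \<in> S \<Longrightarrow> f x \<in> T" "Ck k S f" "Ck k T g"
  shows "Ck k S (\<lambda>x. g (f x))"
  using assms(4,5)
proof (induction k arbitrary: g)
  case 0
  then show ?case using assms(3) by (auto intro: continuous_on_compose2)
next
  case (Suc k)
  have d: "f differentiable (at x)" "g differentiable (at (f x))" if "x \<in> S" for x
    using Suc.prems assms(3) that by auto
  have *: "((\<lambda>y. g (f y)) has_derivative (\<lambda>v. D g (f x) (D f x v))) (at x)" if "x \<in> S" for x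
    using has_derivative_compose[OF D_has[OF d(1)] D_has[OF d(2)]] that by auto
  have "Ck k S (\<lambda>x. \<Sum>b\<in>Basis. (D f x v \<bullet> b) *\<^sub>R D g (f x) b)" for v
  proof (intro Ck_sum Ck_scaleR assms(1))
    fix b :: 'b assume "b \<in> Basis"
    show "Ck k S (\<lambda>x. D f x v \<bullet> b)"
      by (rule Ck_linear_compose[where h = "\<lambda>x. x \<bullet> b", OF _ assms(1)])
        (use Suc.prems in \<open>auto intro!: linearI simp: inner_add_left\<close>)
    show "Ck k S (\<lambda>x. D g (f x) b)" using Suc.IH[of "\<lambda>y. D g y b"] Ck_Suc_imp[OF Suc.prems(1)] Suc.prems(2) by simp
  qed
  moreover have "D (\<lambda>y. g (f y)) x v = (\<Sum>b\<in>Basis. (D f x v \<bullet> b) *\<^sub>R D g (f x) b)" if "x \<in> S" for x v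
    unfolding D_eqI[OF *[OF that]] by (rule linear_basis_expand[OF D_linear[OF d(2)[OF that]]])
  ultimately have "Ck k S (\<lambda>x. D (\<lambda>y. g (f y)) x v)" for v
    using Ck_cong[OF assms(1), of "\<lambda>x. \<Sum>b\<in>Basis. (D f x v \<bullet> b) *\<^sub>R D g (f x) b"
      "\<lambda>x. D (\<lambda>y. g (f y)) x v" k] by auto
  then show ?case using * by (auto simp: differentiable_def)
qed

lemma Ck_local:
  assumes "\<And>x. x \<in> S \<Longrightarrow> \<exists>U. open U \<and> x \<in> U \<and> Ck k U f"
  shows "Ck k S f"
  using assms
proof (induction k arbitrary: f)
  case 0
  have "continuous (at x within S) f" if x: "x \<in> S" for x
  proof -
    obtain U where "open U" "x \<in> U" "continuous_on U f" using 0[OF x] by auto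
    then show ?thesis using continuous_on_eq_continuous_at continuous_at_imp_continuous_at_within by blast
  qed
  then show ?case by (simp add: continuous_on_eq_continuous_within)
next
  case (Suc k)
  have "Ck k S (\<lambda>x. D f x v)" for v
    using Suc.prems by (intro Suc.IH) (metis Ck.simps(2))
  then show ?case using Suc.prems by auto
qed

lemma smooth_onD: "smooth_on S f \<Longrightarrow> open S" "smooth_on S f \<Longrightarrow> Ck k S f"
  by (auto simp: smooth_on_def)

lemma smooth_on_differentiable: "smooth_on S f \<Longrightarrow> x \<in> S \<Longrightarrow> f differentiable (at x)"
  using smooth_onD(2)[of S f "Suc 0"] by auto

lemma smooth_on_cong:
  "smooth_on S f \<Longrightarrow> (\<And>x. x \<in> S \<Longrightarrow> f x = g x) \<Longrightarrow> smooth_on S g"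
  unfolding smooth_on_def using Ck_cong by blast

lemma smooth_on_local:
  assumes "\<And>x. x \<in> S \<Longrightarrow> \<exists>U. x \<in> U \<and> U \<subseteq> S \<and> smooth_on U f"
  shows "smooth_on S f"
proof -
  have "open S" using assms openI unfolding smooth_on_def by (metis open_subopen)
  moreover have "Ck k S f" for k using assms unfolding smooth_on_def by (intro Ck_local) blast
  ultimately show ?thesis by (simp add: smooth_on_def)
qed

lemma smooth_on_subset: "smooth_on S f \<Longrightarrow> open T \<Longrightarrow> T \<subseteq> S \<Longrightarrow> smooth_on T f"
  unfolding smooth_on_def using Ck_local[of T] by blast

lemma smooth_on_const: "open S \<Longrightarrow> smooth_on S (\<lambda>x. a)"
  by (simp add: smooth_on_def Ck_const)

lemma smooth_on_linear: "open S \<Longrightarrow> linear f \<Longrightarrow> smooth_on S f"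
  by (simp add: smooth_on_def Ck_linear)

lemma smooth_on_linear_compose: "linear h \<Longrightarrow> smooth_on S f \<Longrightarrow> smooth_on S (\<lambda>x. h (f x))"
  by (simp add: smooth_on_def Ck_linear_compose)

lemma smooth_on_add: "smooth_on S f \<Longrightarrow> smooth_on S g \<Longrightarrow> smooth_on S (\<lambda>x. f x + g x)"
  by (simp add: smooth_on_def Ck_add)

lemma smooth_on_minus: "smooth_on S f \<Longrightarrow> smooth_on S (\<lambda>x. - f x)"
  by (rule smooth_on_linear_compose) (auto intro: linearI)

lemma smooth_on_diff: "smooth_on S f \<Longrightarrow> smooth_on S g \<Longrightarrow> smooth_on S (\<lambda>x. f x - g x)"
  using smooth_on_add[OF _ smooth_on_minus] by fastforce

lemma smooth_on_sum:
  "open S \<Longrightarrow> (\<And>i. i \<in> I \<Longrightarrow> smooth_on S (f i)) \<Longrightarrow> smooth_on S (\<lambda>x. \<Sum>i\<in>I. f i x)"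
  by (simp add: smooth_on_def Ck_sum)

lemma smooth_on_coordinate: "smooth_on S f \<Longrightarrow> smooth_on S (\<lambda>x. f x \<bullet> b)"
  by (rule smooth_on_linear_compose[where h = "\<lambda>x. x \<bullet> b"]) (auto intro!: linearI simp: inner_add_left)

lemma smooth_on_scaleR:
  "smooth_on S f \<Longrightarrow> smooth_on S g \<Longrightarrow> smooth_on S (\<lambda>x. (f x :: real) *\<^sub>R g x)"
  by (simp add: smooth_on_def Ck_scaleR)

lemma smooth_on_compose:
  "smooth_on S f \<Longrightarrow> smooth_on T g \<Longrightarrow> (\<And>x. x \<in> S \<Longrightarrow> f x \<in> T) \<Longrightarrow> smooth_on S (\<lambda>x. g (f x))"
  unfolding smooth_on_def using Ck_compose by blast

lemma smooth_on_vimage: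
  assumes "smooth_on S f" "open T" shows "open {x \<in> S. f x \<in> T}"
proof -
  have "open S" "continuous_on S f" using smooth_onD(1)[OF assms(1)] smooth_onD(2)[OF assms(1), of 0] by auto
  then have "open (S \<inter> f -` T)" using assms(2) by (intro continuous_open_preimage)
  then show ?thesis by (simp add: vimage_def Int_def)
qed

lemma smooth_on_D_const:
  assumes "smooth_on S f" shows "smooth_on S (\<lambda>x. D f x v)"
proof -
  have "Ck k S (\<lambda>x. D f x v)" for k using smooth_onD(2)[OF assms, of "Suc k"] by simp
  then show ?thesis using smooth_onD(1)[OF assms] by (simp add: smooth_on_def)
qed

lemma smooth_on_D:
  assumes "smooth_on S f" "smooth_on S u"
  shows "smooth_on S (\<lambda>x. D f x (u x))"
proof (rule smooth_on_cong)
  show "smooth_on S (\<lambda>x. \<Sum>b\<in>Basis. (u x \<bullet> b) *\<^sub>R D f x b)"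
  proof (rule smooth_on_sum)
    show "smooth_on S (\<lambda>x. (u x \<bullet> b) *\<^sub>R D f x b)" for b
      using smooth_on_scaleR[OF smooth_on_coordinate[OF assms(2)] smooth_on_D_const[OF assms(1)]] .
  qed (rule smooth_onD(1)[OF assms(1)])
  show "(\<Sum>b\<in>Basis. (u x \<bullet> b) *\<^sub>R D f x b) = D f x (u x)" if "x \<in> S" for x
    by (rule linear_basis_expand[OF D_linear[OF smooth_on_differentiable[OF assms(1) that]], symmetric])
qed

section \<open>Alternating multilinear maps\<close>

definition alt_mult :: "nat \<Rightarrow> ('e::real_vector list \<Rightarrow> 'e) \<Rightarrow> bool" where
  "alt_mult k G \<longleftrightarrow> (\<forall>us. length us = k \<longrightarrow>
     (\<forall>i<k. \<forall>v w r. G (us[i := r *\<^sub>R v + w]) = r *\<^sub>R G (us[i := v]) + G (us[i := w])) \<and>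
     (\<forall>j<k. \<forall>i<j. us ! i = us ! j \<longrightarrow> G us = 0))"

lemma alt_multD:
  assumes "alt_mult k G" "length us = k"
  shows "i < k \<Longrightarrow> G (us[i := r *\<^sub>R v + w]) = r *\<^sub>R G (us[i := v]) + G (us[i := w])"
    and "i < k \<Longrightarrow> j < k \<Longrightarrow> i \<noteq> j \<Longrightarrow> us ! i = us ! j \<Longrightarrow> G us = 0"
  using assms unfolding alt_mult_def by (blast, metis nat_neq_iff)

lemma alt_mult_linear_slot:
  assumes "alt_mult k G" "length us = k" "i < k"
  shows "linear (\<lambda>v. G (us[i := v]))"
proof -
  have "G (us[i := 0]) = 0"
    using alt_multD(1)[OF assms, of "- 1" 0 0] by simp
  then show ?thesis
    using alt_multD(1)[OF assms, of 1] alt_multD(1)[OF assms, of _ _ 0] by (intro linearI) auto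
qed

text \<open>
  Polarization: expand the value with \<open>a + b\<close> in both slots, which is zero.
\<close>

lemma alt_mult_swap:
  assumes G: "alt_mult k G" and len: "length us = k" and ij: "i < k" "j < k" "i \<noteq> j"
  shows "G (us[i := a, j := b]) = - G (us[i := b, j := a])"
proof -
  have lin: "linear (\<lambda>v. G (us[i := c, j := v]))" "linear (\<lambda>v. G (us[i := v, j := c]))" for c
    using alt_mult_linear_slot[OF G, of "us[i := c]" j]
      alt_mult_linear_slot[OF G, of "us[j := c]" i] len ij by (auto simp: list_update_swap)
  have z: "G (us[i := c, j := c]) = 0" for c
    using alt_multD(2)[OF G, of "us[i := c, j := c]" i j] len ij by simp
  have "0 = G (us[i := a + b, j := a + b])" by (simp only: z)
  also have "\<dots> = G (us[i := a, j := a]) + G (us[i := a, j := b])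
      + (G (us[i := b, j := a]) + G (us[i := b, j := b]))"
    by (simp only: linear_add[OF lin(1)] linear_add[OF lin(2)] ac_simps)
  also have "\<dots> = G (us[i := a, j := b]) + G (us[i := b, j := a])" by (simp add: z)
  finally show ?thesis by (simp add: eq_neg_iff_add_eq_0)
qed

text \<open>
  Induction over transpositions, which generate the permutations of a finite set.
\<close>

lemma alt_mult_permute:
  assumes G: "alt_mult k G" and "\<sigma> permutes {..<k}" and "length us = k"
  shows "G (map (\<lambda>i. us ! \<sigma> i) [0..<k]) = real_of_int (sign \<sigma>) *\<^sub>R G us"
  using assms(2) finite_lessThan assms(3)
proof (induction arbitrary: us rule: permutes_induct)
  case id
  then have "map (\<lambda>i. us ! id i) [0..<k] = us" by (intro nth_equalityI) auto
  then show ?case by (simp add: id_def)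
next
  case (swap a b \<sigma>)
  define vs where "vs = map (\<lambda>i. us ! Transposition.transpose a b i) [0..<k]"
  have len: "length vs = k" by (simp add: vs_def)
  have \<sigma>k: "\<sigma> i < k" if "i < k" for i
    using permutes_in_image[OF swap.hyps(4)] that by (metis lessThan_iff)
  have "map (\<lambda>i. us ! (Transposition.transpose a b \<circ> \<sigma>) i) [0..<k] = map (\<lambda>i. vs ! \<sigma> i) [0..<k]"
    using \<sigma>k by (auto simp: vs_def)
  then have 1: "G (map (\<lambda>i. us ! (Transposition.transpose a b \<circ> \<sigma>) i) [0..<k]) = real_of_int (sign \<sigma>) *\<^sub>R G vs"
    using swap.IH[OF len] by (simp only:)
  show ?case
  proof (cases "a = b")
    case True
    then have "vs = us" using swap.prems by (intro nth_equalityI) (auto simp: vs_def)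
    then show ?thesis using 1 True by simp
  next
    case False
    have ab: "a < k" "b < k" using swap.hyps by auto
    have "vs = us[a := us ! b, b := us ! a]"
      using swap.prems by (intro nth_equalityI) (auto simp: vs_def Transposition.transpose_def nth_list_update)
    then have "G vs = - G us"
      using alt_mult_swap[OF G swap.prems ab False, of "us ! b" "us ! a"] by simp
    moreover have "sign (Transposition.transpose a b \<circ> \<sigma>) = - sign \<sigma>"
      using sign_compose[of "Transposition.transpose a b" \<sigma>] False permutes_imp_permutation[OF _ swap.hyps(4)]
      by (simp add: permutation_swap_id sign_swap_id)
    ultimately show ?thesis unfolding 1 by (simp only:) simp
  qed
qed

section \<open>Forms on an open set and their Lie derivative\<close>

text \<open>
  The coordinate expression of a tangent-valued form.  Coordinate expressions are arbitrary away
  from the image of the chart and on lists of the wrong length, so nothing is demanded there.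
\<close>

definition local_form ::
  "'e::euclidean_space set \<Rightarrow> nat \<Rightarrow> ('e \<Rightarrow> 'e list \<Rightarrow> 'e) \<Rightarrow> bool" where
  "local_form S k F \<longleftrightarrow> open S \<and> (\<forall>x\<in>S. alt_mult k (F x)) \<and>
     (\<forall>us. length us = k \<longrightarrow> smooth_on S (\<lambda>x. F x us))"

lemma local_formD:
  assumes "local_form S k F"
  shows "open S" "x \<in> S \<Longrightarrow> alt_mult k (F x)" "length us = k \<Longrightarrow> smooth_on S (\<lambda>x. F x us)"
  using assms by (auto simp: local_form_def)

lemma local_form_cong:
  assumes "local_form S k F" "\<And>x us. x \<in> S \<Longrightarrow> length us = k \<Longrightarrow> F x us = G x us"
  shows "local_form S k G"
proof -
  have "alt_mult k (G x)" if "x \<in> S" for x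
    using local_formD(2)[OF assms(1) that] assms(2)[OF that] unfolding alt_mult_def by simp
  then show ?thesis
    using assms smooth_on_cong[of S "\<lambda>x. F x us" "\<lambda>x. G x us" for us]
    unfolding local_form_def by auto
qed

lemma local_form_scale_add:
  assumes "local_form S k F" "local_form S k G"
  shows "local_form S k (\<lambda>x us. r *\<^sub>R F x us + G x us)"
proof -
  have "alt_mult k (\<lambda>us. r *\<^sub>R F x us + G x us)" if "x \<in> S" for x
    using local_formD(2)[OF assms(1) that] local_formD(2)[OF assms(2) that]
    unfolding alt_mult_def by (auto simp: algebra_simps)
  moreover have "smooth_on S (\<lambda>x. r *\<^sub>R F x us + G x us)" if "length us = k" for us
    using that assms by (intro smooth_on_add smooth_on_scaleR smooth_on_const local_formD) 
  ultimately show ?thesis using local_formD(1)[OF assms(1)] by (simp add: local_form_def)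
qed

lemma local_form_zero: "open S \<Longrightarrow> local_form S k (\<lambda>x us. 0)"
  by (simp add: local_form_def alt_mult_def smooth_on_const)

lemma local_form_sum:
  "open S \<Longrightarrow> (\<And>i. i \<in> I \<Longrightarrow> local_form S k (F i)) \<Longrightarrow> local_form S k (\<lambda>x us. \<Sum>i\<in>I. F i x us)"
proof (induction I rule: infinite_finite_induct)
  case (insert i I)
  then show ?case using local_form_scale_add[of S k "F i" _ 1] by simp
qed (auto intro: local_form_zero)

text \<open>
  Smoothness is known for constant arguments only.  One slot after the other, the argument is
  expanded in the standard basis: the result is a sum of products of its
  components with terms in which that slot is constant.
\<close>

lemma multilinear_smooth:
  fixes F :: "'d::euclidean_space \<Rightarrow> 'e::euclidean_space list \<Rightarrow> 'e"
  assumes S: "open S" and lin: "\<And>x us i. x \<in> S \<Longrightarrow> length us = k \<Longrightarrow> i < k \<Longrightarrow> linear (\<lambda>v. F x (us[i := v]))"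
    and F: "\<And>us. length us = k \<Longrightarrow> smooth_on S (\<lambda>x. F x us)"
    and u: "\<And>i. i < k \<Longrightarrow> smooth_on S (u i)"
  shows "smooth_on S (\<lambda>x. F x (map (\<lambda>i. u i x) [0..<k]))"
proof -
  have "smooth_on S (\<lambda>x. F x (map (\<lambda>i. u i x) [0..<j] @ drop j us))" if "j \<le> k" "length us = k" for j us
    using that
  proof (induction j arbitrary: us)
    case 0
    then show ?case using F by simp
  next
    case (Suc j)
    define G where "G x b = F x (map (\<lambda>i. u i x) [0..<j] @ drop j (us[j := b]))" for x b
    have *: "map (\<lambda>i. u i x) [0..<j] @ drop j (us[j := b])
       = (map (\<lambda>i. u i x) [0..<j] @ drop j us)[j := b]" for x b
      using Suc.prems by (simp add: drop_update_swap list_update_append)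
    have "smooth_on S (\<lambda>x. \<Sum>b\<in>Basis. (u j x \<bullet> b) *\<^sub>R G x b)"
    proof (rule smooth_on_sum[OF S])
      fix b
      have "smooth_on S (\<lambda>x. G x b)" unfolding G_def using Suc by simp
      then show "smooth_on S (\<lambda>x. (u j x \<bullet> b) *\<^sub>R G x b)"
        using smooth_on_scaleR smooth_on_coordinate[OF u[of j]] Suc.prems by (metis Suc_le_lessD)
    qed
    moreover have "(\<Sum>b\<in>Basis. (u j x \<bullet> b) *\<^sub>R G x b)
        = F x (map (\<lambda>i. u i x) [0..<Suc j] @ drop (Suc j) us)" if "x \<in> S" for x
    proof -
      have "linear (G x)"
        unfolding G_def * using lin[OF that, of _ j] Suc.prems by simp
      then have "(\<Sum>b\<in>Basis. (u j x \<bullet> b) *\<^sub>R G x b) = G x (u j x)"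
        by (rule linear_basis_expand[symmetric])
      also have "\<dots> = F x (map (\<lambda>i. u i x) [0..<Suc j] @ drop (Suc j) us)"
        using Suc.prems by (simp add: G_def Cons_nth_drop_Suc[symmetric])
      finally show ?thesis .
    qed
    ultimately show ?case by (rule smooth_on_cong)
  qed
  from this[of k "replicate k undefined"] show ?thesis by simp
qed

text \<open>
  The formula for the Lie derivative on vector fields that are constant.  The bracket of
  \<open>\<xi>\<close> with the constant field \<open>u\<close> is $-D\xi(u)$, so the sum over the arguments enters with
  a positive sign.
\<close>

definition local_lie ::
  "('e::euclidean_space \<Rightarrow> 'e) \<Rightarrow> ('e \<Rightarrow> 'e list \<Rightarrow> 'e) \<Rightarrow> 'e \<Rightarrow> 'e list \<Rightarrow> 'e" where
  "local_lie \<xi> F x us = D (\<lambda>y. F y us) x (\<xi> x) - D \<xi> x (F x us)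
     + (\<Sum>i<length us. F x (us[i := D \<xi> x (us ! i)]))"

text \<open>
  Only the values on the open set matter, so coordinate expressions may be
  replaced by explicit formulas valid on the image of a chart.
\<close>

lemma local_lie_cong:
  assumes "open S" "x \<in> S" "length us = k"
    "\<And>y us. y \<in> S \<Longrightarrow> length us = k \<Longrightarrow> F y us = G y us"
    "\<And>y. y \<in> S \<Longrightarrow> \<xi> y = \<eta> y"
  shows "local_lie \<xi> F x us = local_lie \<eta> G x us"
proof -
  have "D (\<lambda>y. F y us) x = D (\<lambda>y. G y us) x" "D \<xi> x = D \<eta> x"
    using assms by (auto intro: D_cong(1)[OF assms(1,2)])
  then show ?thesis using assms by (simp add: local_lie_def)
qed

lemma local_lie_scale_add:
  assumes "local_form S k F" "local_form S k G" "smooth_on S \<xi>" "x \<in> S" "length us = k"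
  shows "local_lie \<xi> (\<lambda>x us. r *\<^sub>R F x us + G x us) x us = r *\<^sub>R local_lie \<xi> F x us + local_lie \<xi> G x us"
proof -
  have d: "(\<lambda>y. F y us) differentiable (at x)" "(\<lambda>y. G y us) differentiable (at x)"
    using local_formD(3)[OF assms(1,5)] local_formD(3)[OF assms(2,5)] assms(4) smooth_on_differentiable by auto
  have "((\<lambda>y. r *\<^sub>R F y us + G y us) has_derivative (\<lambda>v. r *\<^sub>R D (\<lambda>y. F y us) x v + D (\<lambda>y. G y us) x v)) (at x)"
    by (intro has_derivative_add has_derivative_scaleR_right D_has d)
  moreover have "linear (D \<xi> x)" using assms(3,4) by (intro D_linear smooth_on_differentiable)
  ultimately show ?thesis
    by (simp add: local_lie_def D_eqI linear_add linear_scale sum.distrib scaleR_sum_right algebra_simps)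
qed

lemma local_lie_zero:
  assumes "smooth_on S \<xi>" "x \<in> S" shows "local_lie \<xi> (\<lambda>x us. 0) x us = 0"
  using D_linear[OF smooth_on_differentiable[OF assms]]
  by (simp add: local_lie_def frechet_derivative_const linear_0)

lemma local_lie_sum:
  assumes S: "open S" and F: "\<And>i. i \<in> I \<Longrightarrow> local_form S k (F i)"
    and "smooth_on S \<xi>" "x \<in> S" "length us = k"
  shows "local_lie \<xi> (\<lambda>x us. \<Sum>i\<in>I. F i x us) x us = (\<Sum>i\<in>I. local_lie \<xi> (F i) x us)"
  using F
proof (induction I rule: infinite_finite_induct)
  case (insert i I)
  then show ?case
    using local_lie_scale_add[of S k "F i" "\<lambda>x us. \<Sum>i\<in>I. F i x us" \<xi> x us 1] local_form_sum[OF S, of I k F] assms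
    by simp
qed (use assms in \<open>auto intro: local_lie_zero\<close>)

lemma local_lie_zero_field:
  assumes F: "local_form S k F" and "x \<in> S" "length us = k"
  shows "local_lie (\<lambda>x. 0) F x us = 0"
proof -
  have "D (\<lambda>y. F y us) x 0 = 0"
    using D_linear[OF smooth_on_differentiable[OF local_formD(3)[OF F assms(3)] assms(2)]] by (rule linear_0)
  moreover have "F x (us[i := 0]) = 0" if "i < k" for i
    using linear_0[OF alt_mult_linear_slot[OF local_formD(2)[OF F assms(2)] assms(3) that]] .
  ultimately show ?thesis using assms(3) by (simp add: local_lie_def frechet_derivative_const)
qed

text \<open>
  This is what allows the Lie derivative to be iterated.  If two arguments are equal, then \<open>F\<close>
  vanishes on them at all points, hence so does its derivative; in the sum only the terms for the
  two slots in question survive, and they cancel by antisymmetry.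
\<close>

lemma local_form_lie:
  assumes F: "local_form S k F" and \<xi>: "smooth_on S \<xi>"
  shows "local_form S k (local_lie \<xi> F)"
  unfolding local_form_def
proof (intro conjI ballI allI impI)
  show S: "open S" by (rule local_formD(1)[OF F])
  fix us :: "'a list" assume len: "length us = k"
  have "smooth_on S (\<lambda>x. F x (us[i := D \<xi> x (us ! i)]))" if "i < k" for i
  proof -
    have "smooth_on S (\<lambda>x. F x (map (\<lambda>j. if j = i then D \<xi> x (us ! i) else us ! j) [0..<k]))"
    proof (rule multilinear_smooth[OF S])
      show "smooth_on S (\<lambda>x. if j = i then D \<xi> x (us ! i) else us ! j)" for j
        by (cases "j = i") (simp_all add: smooth_on_D_const[OF \<xi>] smooth_on_const[OF S])
    qed (use alt_mult_linear_slot[OF local_formD(2)[OF F]] local_formD(3)[OF F] in auto)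
    moreover have "map (\<lambda>j. if j = i then D \<xi> x (us ! i) else us ! j) [0..<k] = us[i := D \<xi> x (us ! i)]" for x
      using len by (intro nth_equalityI) auto
    ultimately show ?thesis by simp
  qed
  then have "smooth_on S (\<lambda>x. \<Sum>i<k. F x (us[i := D \<xi> x (us ! i)]))"
    by (intro smooth_on_sum[OF S]) auto
  then show "smooth_on S (\<lambda>x. local_lie \<xi> F x us)"
    unfolding local_lie_def len
    by (rule smooth_on_add[OF smooth_on_diff[OF smooth_on_D[OF local_formD(3)[OF F len] \<xi>]
      smooth_on_D[OF \<xi> local_formD(3)[OF F len]]]])
next
  fix x assume x: "x \<in> S"
  have G: "alt_mult k (F x)" by (rule local_formD(2)[OF F x])
  have S: "open S" by (rule local_formD(1)[OF F])
  have lin: "linear (D \<xi> x)" by (rule D_linear[OF smooth_on_differentiable[OF \<xi> x]])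
  show "alt_mult k (local_lie \<xi> F x)"
    unfolding alt_mult_def
  proof (intro allI impI conjI)
    fix us :: "'a list" and i v w r
    assume len: "length us = k" and i: "i < k"
    have d: "(\<lambda>y. F y vs) differentiable (at x)" if "length vs = k" for vs
      using local_formD(3)[OF F that] x by (rule smooth_on_differentiable)
    have "D (\<lambda>y. F y (us[i := r *\<^sub>R v + w])) x = D (\<lambda>y. r *\<^sub>R F y (us[i := v]) + F y (us[i := w])) x"
      by (rule D_cong(1)[OF S x]) (use alt_multD(1)[OF local_formD(2)[OF F] len i] in auto)
    also have "\<dots> = (\<lambda>u. r *\<^sub>R D (\<lambda>y. F y (us[i := v])) x u + D (\<lambda>y. F y (us[i := w])) x u)"
      by (rule frechet_derivative_at[symmetric]) (intro has_derivative_add has_derivative_scaleR_right D_has d, simp_all add: len)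
    finally have 1: "D (\<lambda>y. F y (us[i := r *\<^sub>R v + w])) x =
      (\<lambda>u. r *\<^sub>R D (\<lambda>y. F y (us[i := v])) x u + D (\<lambda>y. F y (us[i := w])) x u)" .
    have 2: "F x (us[i := a, j := D \<xi> x (us[i := a] ! j)]) =
       (if j = i then F x (us[i := D \<xi> x a]) else F x (us[j := D \<xi> x (us ! j), i := a]))" for a j
      using len i by (auto simp: list_update_swap)
    have 3: "F x (us[i := r *\<^sub>R v + w, j := D \<xi> x (us[i := r *\<^sub>R v + w] ! j)]) =
       r *\<^sub>R F x (us[i := v, j := D \<xi> x (us[i := v] ! j)]) + F x (us[i := w, j := D \<xi> x (us[i := w] ! j)])" for j
      unfolding 2 using alt_multD(1)[OF G _ i] len by (simp add: linear_add[OF lin] linear_scale[OF lin])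
    show "local_lie \<xi> F x (us[i := r *\<^sub>R v + w]) =
       r *\<^sub>R local_lie \<xi> F x (us[i := v]) + local_lie \<xi> F x (us[i := w])"
      unfolding local_lie_def 1 length_list_update 3 alt_multD(1)[OF G len i]
      by (simp add: linear_add[OF lin] linear_scale[OF lin] sum.distrib scaleR_sum_right algebra_simps)
  next
    fix us :: "'a list" and i j
    assume len: "length us = k" and j: "j < k" and ij: "i < j" and eq: "us ! i = us ! j"
    have i: "i < k" using ij j by simp
    have z: "F y us = 0" if "y \<in> S" for y
      using alt_multD(2)[OF local_formD(2)[OF F that] len i j] ij eq by simp
    have 1: "D (\<lambda>y. F y us) x = (\<lambda>u. 0)"
      using D_cong(1)[OF S x, of "\<lambda>y. F y us" "\<lambda>y. 0"] z by (simp add: frechet_derivative_const)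
    define T where "T l = F x (us[l := D \<xi> x (us ! l)])" for l
    have T0: "T l = 0" if "l < k" "l \<noteq> i" "l \<noteq> j" for l
      unfolding T_def using alt_multD(2)[OF G, of "us[l := D \<xi> x (us ! l)]" i j] len i j ij eq that by simp
    have "T i + T j = 0"
      using alt_mult_swap[OF G len i j, of "D \<xi> x (us ! i)" "us ! i"] ij eq
      unfolding T_def by (metis add.left_inverse list_update_id nat_neq_iff list_update_swap)
    moreover have "(\<Sum>l<k. T l) = (\<Sum>l\<in>{i, j}. T l)"
      using i j T0 by (intro sum.mono_neutral_right) auto
    ultimately have "(\<Sum>l<k. T l) = 0" using ij by simp
    then show "local_lie \<xi> F x us = 0"
      using z[OF x] linear_0[OF lin] by (simp add: local_lie_def 1 len T_def)
  qed
qed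

section \<open>The bracket of a form with a vector field\<close>

lemma lie_deriv_on_const_fields:
  assumes "local_form S k F" "x \<in> S" "length us = k"
  shows "lie_deriv_on_fields \<xi> F (map (\<lambda>u _. u) us) x = local_lie \<xi> F x us"
proof -
  have "on_fields F ((map (\<lambda>u _. u) us)[i := lie \<xi> (map (\<lambda>u _. u) us ! i)]) x = - F x (us[i := D \<xi> x (us ! i)])"
    if i: "i < k" for i
  proof -
    have "on_fields F ((map (\<lambda>u _. u) us)[i := lie \<xi> (map (\<lambda>u _. u) us ! i)]) x = F x (us[i := - D \<xi> x (us ! i)])"
      using i assms(3) by (simp add: on_fields_def map_update lie_def frechet_derivative_const o_def)
    also have "\<dots> = - F x (us[i := D \<xi> x (us ! i)])"
      using linear_neg[OF alt_mult_linear_slot[OF local_formD(2)[OF assms(1,2)]]] i assms(3) by blast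
    finally show ?thesis .
  qed
  then have "(\<Sum>i<length us. on_fields F ((map (\<lambda>u _. u) us)[i := lie \<xi> (map (\<lambda>u _. u) us ! i)]) x)
      = - (\<Sum>i<length us. F x (us[i := D \<xi> x (us ! i)]))"
    using assms(3) by (simp add: sum_negf)
  then show ?thesis
    by (simp add: lie_deriv_on_fields_def local_lie_def lie_def on_fields_def o_def)
qed

text \<open>
  Composition with a transposition shows that evaluating \<open>\<sigma>\<close> at 0 or at any other slot gives the
  same sum.  Averaging over the slots reduces the claim to $\sum_j f(\sigma j) = \sum_j f(j)$ and to
  the number of permutations.
\<close>

lemma sum_permutations_first:
  fixes f :: "nat \<Rightarrow> 'a::real_vector"
  assumes "0 < k"
  shows "(\<Sum>\<sigma> | \<sigma> permutes {..<k}. f (\<sigma> 0)) = fact (k - 1) *\<^sub>R (\<Sum>j<k. f j)"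
proof -
  let ?P = "{\<sigma>. \<sigma> permutes {..<k}}"
  have eq: "(\<Sum>\<sigma>\<in>?P. f (\<sigma> 0)) = (\<Sum>\<sigma>\<in>?P. f (\<sigma> j))" if "j < k" for j
    using sum_permutations_compose_right[OF permutes_swap_id[of j "{..<k}" 0], of "\<lambda>\<sigma>. f (\<sigma> 0)"] that assms by (simp add: o_def)
  have "real k *\<^sub>R (\<Sum>\<sigma>\<in>?P. f (\<sigma> 0)) = (\<Sum>j<k. \<Sum>\<sigma>\<in>?P. f (\<sigma> 0))"
    by (simp add: sum_constant_scaleR)
  also have "\<dots> = (\<Sum>j<k. \<Sum>\<sigma>\<in>?P. f (\<sigma> j))"
    by (rule sum.cong[OF refl]) (use eq in simp)
  also have "\<dots> = (\<Sum>\<sigma>\<in>?P. \<Sum>j<k. f (\<sigma> j))" by (rule sum.swap)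
  also have "\<dots> = (\<Sum>\<sigma>\<in>?P. \<Sum>j<k. f j)"
    by (intro sum.cong refl sum.permute[symmetric, unfolded o_def]) simp
  also have "\<dots> = fact k *\<^sub>R (\<Sum>j<k. f j)"
    by (simp add: card_permutations[of "{..<k}" k] sum_constant_scaleR)
  also have "\<dots> = real k *\<^sub>R (fact (k - 1) *\<^sub>R (\<Sum>j<k. f j))"
    using assms by (simp add: fact_reduce)
  finally show ?thesis unfolding scaleR_cancel_left using assms by auto
qed

text \<open>
  This is $[K,X]^{FN} = -\mathcal L_X K$.  As \<open>l = 0\<close>, only the first and the third of the five
  sums are present.  By antisymmetry every permutation contributes the same to the first
  sum, $k!$ times $[K(X_1,\dots,X_k),X]$, and the third sum contains each of the $k$ terms
  $K(X_1,\dots,[X,X_i],\dots,X_k)$ exactly $(k-1)!$ times; the prefactors remove these numbers.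
\<close>

lemma fn_on_const_fields:
  assumes F: "local_form S k F" and \<xi>: "smooth_on S \<xi>" and \<Xi>: "\<And>y. X y [] = \<xi> y"
    and x: "x \<in> S" and len: "length us = k"
  shows "fn_on_fields k 0 F X (map (\<lambda>u _. u) us) x = - local_lie \<xi> F x us"
proof -
  let ?P = "{\<sigma>. \<sigma> permutes {..<k}}"
  let ?Y = "\<lambda>\<sigma>. map (\<lambda>i. map (\<lambda>u _. u) us ! \<sigma> i) [0..<k]"
  have S: "open S" by (rule local_formD(1)[OF F])
  have G: "alt_mult k (F x)" by (rule local_formD(2)[OF F x])
  have sg: "real_of_int (sign \<sigma>) * real_of_int (sign \<sigma>) = 1" for \<sigma> :: "nat \<Rightarrow> nat"
    by (simp add: sign_def)
  have \<sigma>k: "\<sigma> i < k" if "\<sigma> \<in> ?P" "i < k" for i \<sigma>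
    using permutes_in_image[of \<sigma> "{..<k}"] that by auto
  have Y: "map (\<lambda>X. X y) (?Y \<sigma>) = map (\<lambda>i. us ! \<sigma> i) [0..<k]" if "\<sigma> \<in> ?P" for \<sigma> y
    using \<sigma>k[OF that] len by simp
  have X0: "on_fields X [] = \<xi>" by (auto simp: on_fields_def \<Xi>)
  have lie1: "lie (on_fields F (?Y \<sigma>)) \<xi> x = real_of_int (sign \<sigma>) *\<^sub>R lie (\<lambda>y. F y us) \<xi> x"
    if \<sigma>: "\<sigma> \<in> ?P" for \<sigma>
  proof -
    have *: "on_fields F (?Y \<sigma>) y = real_of_int (sign \<sigma>) *\<^sub>R F y us" if "y \<in> S" for y
      unfolding on_fields_def Y[OF \<sigma>] using alt_mult_permute[OF local_formD(2)[OF F that] _ len] \<sigma> by simp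
    have "D (on_fields F (?Y \<sigma>)) x = D (\<lambda>y. real_of_int (sign \<sigma>) *\<^sub>R F y us) x"
      by (rule D_cong(1)[OF S x *])
    also have "\<dots> = (\<lambda>v. real_of_int (sign \<sigma>) *\<^sub>R D (\<lambda>y. F y us) x v)"
      by (rule frechet_derivative_at[symmetric])
        (intro has_derivative_scaleR_right D_has smooth_on_differentiable[OF local_formD(3)[OF F len] x])
    finally show ?thesis
      using *[OF x] linear_scale[OF D_linear[OF smooth_on_differentiable[OF \<xi> x]]]
      by (simp add: lie_def scaleR_diff_right)
  qed
  have t1: "(\<Sum>\<sigma>\<in>?P. real_of_int (sign \<sigma>) *\<^sub>R lie (on_fields F (?Y \<sigma>)) \<xi> x)
     = fact k *\<^sub>R lie (\<lambda>y. F y us) \<xi> x"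
    using lie1 sg by (simp add: card_permutations[of "{..<k}" k] sum_constant_scaleR)
  have t2: "(\<Sum>\<sigma>\<in>?P. real_of_int (sign \<sigma>) *\<^sub>R on_fields F (lie \<xi> (?Y \<sigma> ! 0) # drop 1 (?Y \<sigma>)) x)
     = - (fact (k - 1) *\<^sub>R (\<Sum>i<k. F x (us[i := D \<xi> x (us ! i)])))" if k: "0 < k"
  proof -
    have "on_fields F (lie \<xi> (?Y \<sigma> ! 0) # drop 1 (?Y \<sigma>)) x
       = - (real_of_int (sign \<sigma>) *\<^sub>R F x (us[\<sigma> 0 := D \<xi> x (us ! \<sigma> 0)]))" if \<sigma>: "\<sigma> \<in> ?P" for \<sigma>
    proof -
      have inj: "\<sigma> 0 = \<sigma> i \<longleftrightarrow> i = 0" for i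
        using permutes_inj[of \<sigma> "{..<k}"] \<sigma> by (auto dest: injD)
      have "map (\<lambda>X. X x) (lie \<xi> (?Y \<sigma> ! 0) # drop 1 (?Y \<sigma>))
          = map (\<lambda>i. us[\<sigma> 0 := - D \<xi> x (us ! \<sigma> 0)] ! \<sigma> i) [0..<k]"
        using len k \<sigma>k[OF \<sigma>] inj
        by (intro nth_equalityI) (auto simp: nth_Cons' lie_def frechet_derivative_const nth_list_update)
      then have "on_fields F (lie \<xi> (?Y \<sigma> ! 0) # drop 1 (?Y \<sigma>)) x
          = real_of_int (sign \<sigma>) *\<^sub>R F x (us[\<sigma> 0 := - D \<xi> x (us ! \<sigma> 0)])"
        using alt_mult_permute[OF G, of \<sigma> "us[\<sigma> 0 := - D \<xi> x (us ! \<sigma> 0)]"] \<sigma> len by (simp add: on_fields_def)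
      then show ?thesis
        using linear_neg[OF alt_mult_linear_slot[OF G len \<sigma>k[OF \<sigma> k]]] by simp
    qed
    then have "(\<Sum>\<sigma>\<in>?P. real_of_int (sign \<sigma>) *\<^sub>R on_fields F (lie \<xi> (?Y \<sigma> ! 0) # drop 1 (?Y \<sigma>)) x)
       = - (\<Sum>\<sigma>\<in>?P. F x (us[\<sigma> 0 := D \<xi> x (us ! \<sigma> 0)]))"
      using sg by (simp add: sum_negf)
    then show ?thesis using sum_permutations_first[OF k, of "\<lambda>i. F x (us[i := D \<xi> x (us ! i)])"] by simp
  qed
  show ?thesis
    unfolding fn_on_fields_def Let_def local_lie_def
    using t1 t2 X0 len by (simp add: lie_def)
qed

section \<open>Charts and smooth maps between manifolds\<close>

lemma chart_inv_chart: "is_chart c \<Longrightarrow> p \<in> fst c \<Longrightarrow> chart_inv c (snd c p) = p"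
  by (simp add: is_chart_def chart_inv_def)

lemma chart_chart_inv:
  "x \<in> chart_image c \<Longrightarrow> snd c (chart_inv c x) = x" "x \<in> chart_image c \<Longrightarrow> chart_inv c x \<in> fst c"
  by (auto simp: chart_image_def chart_inv_def f_inv_into_f inv_into_into)

lemma chartsD:
  "c \<in> charts A \<Longrightarrow> is_chart c" "c \<in> charts A \<Longrightarrow> fst c \<subseteq> points A"
  "c \<in> charts A \<Longrightarrow> open (chart_image c)"
  by (auto simp: charts_def is_chart_def)

lemma charts_at_iff: "c \<in> charts_at A p \<longleftrightarrow> c \<in> charts A \<and> p \<in> fst c"
  by (simp add: charts_at_def)

lemma chart_image_Collect:
  assumes "is_chart c"
  shows "snd c ` {p \<in> fst c. P p} = {x \<in> chart_image c. P (chart_inv c x)}"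
  using chart_inv_chart[OF assms] by (auto simp: chart_image_def)

abbreviation coord_rep :: "('a, 'e) chart \<Rightarrow> ('b, 'f) chart \<Rightarrow> ('a \<Rightarrow> 'b) \<Rightarrow> 'e \<Rightarrow> 'f" where
  "coord_rep c d f \<equiv> \<lambda>x. snd d (f (chart_inv c x))"

text \<open>
  Smoothness of \<open>f\<close> in one pair of charts.  It includes the openness of the part of the chart
  that \<open>f\<close> maps into the other chart; this replaces the continuity of \<open>f\<close>, for which the point
  sets would need a topology.
\<close>

definition smooth_rep ::
  "('a, 'e::euclidean_space) chart \<Rightarrow> ('b, 'f::euclidean_space) chart \<Rightarrow> ('a \<Rightarrow> 'b) \<Rightarrow> bool" where
  "smooth_rep c d f \<longleftrightarrow> smooth_on (snd c ` {p \<in> fst c. f p \<in> fst d}) (coord_rep c d f)"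

lemma compatible_iff: "compatible c d \<longleftrightarrow> smooth_rep c d (\<lambda>x. x) \<and> smooth_rep d c (\<lambda>x. x)"
  by (simp add: compatible_def smooth_rep_def Int_def conj_commute)

lemma smooth_rep_differentiable:
  "smooth_rep c d f \<Longrightarrow> p \<in> fst c \<Longrightarrow> f p \<in> fst d \<Longrightarrow> coord_rep c d f differentiable (at (snd c p))"
  unfolding smooth_rep_def by (erule smooth_on_differentiable) auto

text \<open>
  The representative of \<open>g \<circ> f\<close> is the composite of the representatives only where \<open>f\<close> stays in
  the intermediate chart.  These points form a neighbourhood, so that derivatives can be compared.
\<close>

lemma chain_neighbourhood:
  assumes c: "is_chart c" and d: "is_chart d"
    and f: "smooth_rep c d f" and g: "smooth_rep d e g"
    and p: "p \<in> fst c" "f p \<in> fst d" "g (f p) \<in> fst e"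
  obtains U where "open U" "snd c p \<in> U" "U \<subseteq> snd c ` {p \<in> fst c. f p \<in> fst d \<and> g (f p) \<in> fst e}"
    "\<And>x. x \<in> U \<Longrightarrow> coord_rep c d f x \<in> snd d ` {q \<in> fst d. g q \<in> fst e}"
    "\<And>x. x \<in> U \<Longrightarrow> coord_rep c e (\<lambda>x. g (f x)) x = coord_rep d e g (coord_rep c d f x)"
proof
  let ?W = "snd d ` {q \<in> fst d. g q \<in> fst e}"
  let ?U = "{x \<in> snd c ` {p \<in> fst c. f p \<in> fst d}. coord_rep c d f x \<in> ?W}"
  have "open ?W" using g by (auto simp: smooth_rep_def dest: smooth_onD)
  then show "open ?U" using f unfolding smooth_rep_def by (intro smooth_on_vimage)
  show "snd c p \<in> ?U" using p chart_inv_chart[OF c] by auto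
  show "?U \<subseteq> snd c ` {p \<in> fst c. f p \<in> fst d \<and> g (f p) \<in> fst e}"
  proof
    fix x assume "x \<in> ?U"
    then obtain p q where "x = snd c p" "p \<in> fst c" "f p \<in> fst d" "snd d (f p) = snd d q" "q \<in> fst d" "g q \<in> fst e"
      using chart_inv_chart[OF c] by auto
    moreover from this have "f p = q" using d by (auto simp: is_chart_def dest: inj_onD)
    ultimately show "x \<in> snd c ` {p \<in> fst c. f p \<in> fst d \<and> g (f p) \<in> fst e}" by auto
  qed
  show "coord_rep c d f x \<in> ?W" if "x \<in> ?U" for x using that by simp
  show "coord_rep c e (\<lambda>x. g (f x)) x = coord_rep d e g (coord_rep c d f x)" if x: "x \<in> ?U" for x
  proof -
    obtain p where "x = snd c p" "p \<in> fst c" "f p \<in> fst d" using x by blast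
    then show ?thesis by (simp add: chart_inv_chart[OF c] chart_inv_chart[OF d])
  qed
qed

lemma D_coord_rep_compose:
  assumes c: "is_chart c" and d: "is_chart d"
    and f: "smooth_rep c d f" and g: "smooth_rep d e g"
    and p: "p \<in> fst c" "f p \<in> fst d" "g (f p) \<in> fst e"
  shows "D (coord_rep c e (\<lambda>x. g (f x))) (snd c p) v
     = D (coord_rep d e g) (snd d (f p)) (D (coord_rep c d f) (snd c p) v)" (is ?D)
    and "coord_rep c e (\<lambda>x. g (f x)) differentiable (at (snd c p))" (is ?diff)
proof -
  from chain_neighbourhood[OF assms] obtain U where U: "open U" "snd c p \<in> U"
    "\<And>x. x \<in> U \<Longrightarrow> coord_rep c e (\<lambda>x. g (f x)) x = coord_rep d e g (coord_rep c d f x)"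
    by metis
  have fp: "coord_rep c d f (snd c p) = snd d (f p)" using chart_inv_chart[OF c p(1)] by simp
  have df: "coord_rep c d f differentiable (at (snd c p))"
    by (rule smooth_rep_differentiable[OF f p(1,2)])
  have dg: "coord_rep d e g differentiable (at (coord_rep c d f (snd c p)))"
    unfolding fp by (rule smooth_rep_differentiable[OF g p(2,3)])
  have "((\<lambda>x. coord_rep d e g (coord_rep c d f x)) has_derivative
      (\<lambda>v. D (coord_rep d e g) (coord_rep c d f (snd c p)) (D (coord_rep c d f) (snd c p) v))) (at (snd c p))"
    by (rule has_derivative_compose[OF D_has[OF df] D_has[OF dg]])
  then have "((coord_rep c e (\<lambda>x. g (f x))) has_derivative
      (\<lambda>v. D (coord_rep d e g) (snd d (f p)) (D (coord_rep c d f) (snd c p) v))) (at (snd c p))"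
    unfolding fp by (rule has_derivative_transform_within_open[OF _ U(1,2)]) (simp add: U(3))
  then show ?D ?diff by (auto intro: D_eqI simp: differentiable_def)
qed

text \<open>
  Charts of the maximal atlas are compatible with the given atlas by definition; to compare two of
  them, pass through a chart of the atlas around each common point.
\<close>

lemma charts_smooth_rep:
  assumes A: "smooth_atlas A" and c: "c \<in> charts A" and d: "d \<in> charts A"
  shows "smooth_rep c d (\<lambda>x. x)"
  unfolding smooth_rep_def
proof (rule smooth_on_local)
  fix x assume "x \<in> snd c ` {p \<in> fst c. p \<in> fst d}"
  then obtain p where p: "p \<in> fst c" "p \<in> fst d" "x = snd c p" by auto
  with c obtain a where a: "a \<in> A" "p \<in> fst a" using chartsD(2) by (fastforce simp: points_def)
  have rep: "smooth_rep c a (\<lambda>x. x)" "smooth_rep a d (\<lambda>x. x)"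
    using c d a by (auto simp: charts_def compatible_iff)
  have ia: "is_chart a" using A a by (simp add: smooth_atlas_def)
  obtain U where U: "open U" "snd c p \<in> U" "U \<subseteq> snd c ` {p \<in> fst c. p \<in> fst a \<and> p \<in> fst d}"
    "\<And>x. x \<in> U \<Longrightarrow> coord_rep c a (\<lambda>x. x) x \<in> snd a ` {q \<in> fst a. q \<in> fst d}"
    "\<And>x. x \<in> U \<Longrightarrow> coord_rep c d (\<lambda>x. x) x = coord_rep a d (\<lambda>x. x) (coord_rep c a (\<lambda>x. x) x)"
    by (rule chain_neighbourhood[where f = "\<lambda>x. x" and g = "\<lambda>x. x", OF chartsD(1)[OF c] ia rep p(1) a(2) p(2)]) (rule that; assumption)
  have s: "smooth_on U (coord_rep c a (\<lambda>x. x))"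
    using rep(1) U(1,3) unfolding smooth_rep_def by (elim smooth_on_subset) auto
  have "smooth_on U (\<lambda>x. coord_rep a d (\<lambda>x. x) (coord_rep c a (\<lambda>x. x) x))"
    by (rule smooth_on_compose[OF s rep(2)[unfolded smooth_rep_def]]) (use U(4) in auto)
  then have "smooth_on U (coord_rep c d (\<lambda>x. x))"
    by (rule smooth_on_cong) (use U(5) in auto)
  then show "\<exists>U. x \<in> U \<and> U \<subseteq> snd c ` {p \<in> fst c. p \<in> fst d} \<and> smooth_on U (coord_rep c d (\<lambda>x. x))"
    using U(2,3) p(3) by (intro exI[of _ U]) auto
qed

lemma charts_compatible:
  "smooth_atlas A \<Longrightarrow> c \<in> charts A \<Longrightarrow> d \<in> charts A \<Longrightarrow> compatible c d"
  by (simp add: compatible_iff charts_smooth_rep)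

lemma atlas_subset_charts: "smooth_atlas A \<Longrightarrow> A \<subseteq> charts A"
  by (auto simp: smooth_atlas_def charts_def points_def)

section \<open>Tangent vectors and differentials\<close>

lemma D_transition_self:
  assumes "c \<in> charts A" "p \<in> fst c"
  shows "D (coord_rep c c (\<lambda>x. x)) (snd c p) u = u"
proof -
  have "D (coord_rep c c (\<lambda>x. x)) (snd c p) = D (\<lambda>x. x) (snd c p)"
    by (rule D_cong(1)[OF chartsD(3)[OF assms(1)]]) (auto simp: chart_chart_inv(1) chart_image_def intro: assms(2))
  then show ?thesis by simp
qed

lemma D_transition_linear:
  assumes "smooth_atlas A" "c \<in> charts_at A p" "d \<in> charts_at A p"
  shows "linear (D (coord_rep c d (\<lambda>x. x)) (snd c p))"
  using assms by (intro D_linear smooth_rep_differentiable charts_smooth_rep) (auto simp: charts_at_iff)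

lemma tspaceD:
  assumes "v \<in> tspace A p" "c \<in> charts_at A p" "d \<in> charts_at A p"
  shows "v d = D (coord_rep c d (\<lambda>x. x)) (snd c p) (v c)"
  using assms unfolding tspace_def mem_Collect_eq by blast

text \<open>
  One chart determines a tangent vector, so equations between tangent vectors can be
  checked in whatever chart is convenient.
\<close>

lemma tspace_eqI:
  assumes "v \<in> tspace A p" "w \<in> tspace A p" "c \<in> charts_at A p" "v c = w c"
  shows "v = w"
proof
  fix d
  show "v d = w d"
  proof (cases "d \<in> charts_at A p")
    case True
    then show ?thesis using tspaceD[of _ A p c d] assms by metis
  next
    case False
    then have "v d = 0" "w d = 0" using assms(1,2) unfolding tspace_def by blast+
    then show ?thesis by simp
  qed
qed

lemma tvec_of_self: "c \<in> charts_at A p \<Longrightarrow> tvec_of A c p u c = u"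
  using D_transition_self[of c A p u] by (simp add: tvec_of_def charts_at_iff)

text \<open>
  The cocycle identity of the derivatives of the transition maps.
\<close>

lemma tvec_of_tspace:
  assumes "smooth_atlas A" "c \<in> charts_at A p"
  shows "tvec_of A c p u \<in> tspace A p"
  unfolding tspace_def mem_Collect_eq
proof (intro conjI ballI allI impI)
  fix d e assume de: "d \<in> charts_at A p" "e \<in> charts_at A p"
  have "D (coord_rep c e (\<lambda>x. x)) (snd c p) u
     = D (coord_rep d e (\<lambda>x. x)) (snd d p) (D (coord_rep c d (\<lambda>x. x)) (snd c p) u)"
    using assms de by (intro D_coord_rep_compose(1)[where f = "\<lambda>x. x" and g = "\<lambda>x. x"] charts_smooth_rep[OF assms(1)])
      (auto simp: charts_at_iff chartsD)
  then show "tvec_of A c p u e = D (coord_rep d e (\<lambda>x. x)) (snd d p) (tvec_of A c p u d)"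
    using de by (simp add: tvec_of_def)
qed (simp add: tvec_of_def)

lemma tvec_of_coord:
  "smooth_atlas A \<Longrightarrow> c \<in> charts_at A p \<Longrightarrow> v \<in> tspace A p \<Longrightarrow> tvec_of A c p (v c) = v"
  by (rule tspace_eqI[OF tvec_of_tspace]) (auto simp: tvec_of_self)

lemma tvec_of_scale_add:
  assumes "smooth_atlas A" "c \<in> charts_at A p"
  shows "tvec_of A c p (r *\<^sub>R v + w) = (\<lambda>d. r *\<^sub>R tvec_of A c p v d + tvec_of A c p w d)"
  using D_transition_linear[OF assms] by (auto simp: tvec_of_def linear_add linear_scale)

text \<open>
  The differential is defined by an arbitrary chart around \<open>p\<close>; the chain rule allows it to be
  computed in any pair of charts in which \<open>f\<close> is smooth.
\<close>

lemma dmap_eq_tvec_of: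
  assumes A: "smooth_atlas A" and B: "smooth_atlas B" and c: "c \<in> charts_at A p" and d: "d \<in> charts_at B (f p)"
    and f: "smooth_rep c d f" and v: "v \<in> tspace A p"
  shows "dmap A B f p v = tvec_of B d (f p) (D (coord_rep c d f) (snd c p) (v c))"
proof
  fix e
  define c0 where "c0 = (SOME c. c \<in> charts_at A p)"
  have c0: "c0 \<in> charts_at A p" unfolding c0_def using c by (rule someI)
  show "dmap A B f p v e = tvec_of B d (f p) (D (coord_rep c d f) (snd c p) (v c)) e"
  proof (cases "e \<in> charts_at B (f p)")
    case e: True
    have cc: "c \<in> charts A" "p \<in> fst c" "c0 \<in> charts A" "p \<in> fst c0" "d \<in> charts B" "f p \<in> fst d" "e \<in> charts B" "f p \<in> fst e"
      using c d e c0 by (auto simp: charts_at_iff)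
    have r0: "smooth_rep c0 c (\<lambda>x. x)" by (rule charts_smooth_rep[OF A cc(3,1)])
    have r1: "smooth_rep d e (\<lambda>x. x)" by (rule charts_smooth_rep[OF B cc(5,7)])
    obtain U where U: "open U" "snd c0 p \<in> U" "U \<subseteq> snd c0 ` {p \<in> fst c0. p \<in> fst c \<and> f p \<in> fst d}"
      "\<And>x. x \<in> U \<Longrightarrow> coord_rep c0 c (\<lambda>x. x) x \<in> snd c ` {q \<in> fst c. f q \<in> fst d}"
      "\<And>x. x \<in> U \<Longrightarrow> coord_rep c0 d f x = coord_rep c d f (coord_rep c0 c (\<lambda>x. x) x)"
      by (rule chain_neighbourhood[where f = "\<lambda>x. x" and g = f, OF chartsD(1)[OF cc(3)] chartsD(1)[OF cc(1)] r0 f cc(4,2,6)]) (rule that; assumption)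
    have nb: "coord_rep c e f differentiable (at (snd c p))"
       "D (coord_rep c e f) (snd c p) v = D (coord_rep d e (\<lambda>x. x)) (snd d (f p)) (D (coord_rep c d f) (snd c p) v)" for v
      using D_coord_rep_compose[OF chartsD(1)[OF cc(1)] chartsD(1)[OF cc(5)] f r1] cc by auto
    have p0: "coord_rep c0 c (\<lambda>x. x) (snd c0 p) = snd c p" using chart_inv_chart[OF chartsD(1)[OF cc(3)] cc(4)] by simp
    have *: "coord_rep c0 e f x = coord_rep c e f (coord_rep c0 c (\<lambda>x. x) x)" if "x \<in> U" for x
    proof -
      have "chart_inv c0 x \<in> fst c" using that U(3) chart_inv_chart[OF chartsD(1)[OF cc(3)]] by auto
      then show ?thesis using chart_inv_chart[OF chartsD(1)[OF cc(1)]] by simp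
    qed
    have "D (coord_rep c0 e f) (snd c0 p) = D (\<lambda>x. coord_rep c e f (coord_rep c0 c (\<lambda>x. x) x)) (snd c0 p)"
      by (rule D_cong(1)[OF U(1,2) *])
    then have "D (coord_rep c0 e f) (snd c0 p) (v c0)
      = D (coord_rep c e f) (snd c p) (D (coord_rep c0 c (\<lambda>x. x)) (snd c0 p) (v c0))"
      using D_compose[OF smooth_rep_differentiable[OF r0 cc(4,2)], of "coord_rep c e f" "v c0"] nb(1) p0 by simp
    also have "D (coord_rep c0 c (\<lambda>x. x)) (snd c0 p) (v c0) = v c" using tspaceD[OF v c0 c] by simp
    finally show ?thesis unfolding dmap_def Let_def c0_def[symmetric] tvec_of_def using e nb(2) by simp
  qed (simp add: dmap_def Let_def tvec_of_def)
qed

text \<open>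
  Tangent vectors are determined by their coordinates in one chart, so the coordinate expression
  in that chart knows all components there of all values of \<open>K\<close>.  This holds for any
  function \<open>K\<close>, which makes it available for brackets and Lie derivatives.
\<close>

section \<open>Coordinate expressions of forms\<close>

lemma loc_at_point:
  assumes "smooth_atlas A" "c \<in> charts_at A p" "set vs \<subseteq> tspace A p"
  shows "K p vs c = loc A K c (snd c p) (map (\<lambda>v. v c) vs)"
proof -
  have "map (tvec_of A c p) (map (\<lambda>v. v c) vs) = vs"
    using tvec_of_coord[OF assms(1,2)] assms(3) by (auto simp: map_idI subset_iff)
  then show ?thesis
    using chart_inv_chart[OF chartsD(1), of c A p] assms(2) by (simp add: loc_def charts_at_iff)
qed

lemma local_form_loc:
  assumes A: "smooth_atlas A" and \<Psi>: "\<Psi> \<in> tforms A k" and c: "c \<in> charts A"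
  shows "local_form (chart_image c) k (loc A \<Psi> c)"
  unfolding local_form_def
proof (intro conjI ballI allI impI)
  show "open (chart_image c)" by (rule chartsD(3)[OF c])
  show "smooth_on (chart_image c) (\<lambda>x. loc A \<Psi> c x us)" if "length us = k" for us
    using \<Psi> c that by (simp add: tforms_def)
  fix x assume x: "x \<in> chart_image c"
  define p where "p = chart_inv c x"
  have p: "p \<in> points A" and cp: "c \<in> charts_at A p"
    using chart_chart_inv(2)[OF x] chartsD(2)[OF c] c by (auto simp: p_def charts_at_iff)
  have am: "alternating_multilinear k (tspace A p) (tspace A p) (\<Psi> p)" using \<Psi> p by (simp add: tforms_def)
  let ?t = "tvec_of A c p"
  have ts: "?t u \<in> tspace A p" for u by (rule tvec_of_tspace[OF A cp])
  show "alt_mult k (loc A \<Psi> c x)"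
    unfolding alt_mult_def
  proof (intro allI impI conjI)
    fix us :: "'b list" and i v w r assume us: "length us = k" and i: "i < k"
    have "\<Psi> p ((map ?t us)[i := \<lambda>d. r *\<^sub>R ?t v d + ?t w d])
      = (\<lambda>d. r *\<^sub>R \<Psi> p ((map ?t us)[i := ?t v]) d + \<Psi> p ((map ?t us)[i := ?t w]) d)"
      using am us i ts unfolding alternating_multilinear_def by (auto simp: image_subset_iff)
    then show "loc A \<Psi> c x (us[i := r *\<^sub>R v + w]) = r *\<^sub>R loc A \<Psi> c x (us[i := v]) + loc A \<Psi> c x (us[i := w])"
      unfolding loc_def p_def[symmetric] map_update tvec_of_scale_add[OF A cp] by simp
  next
    fix us :: "'b list" and i j assume us: "length us = k" and "j < k" "i < j" "us ! i = us ! j"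
    then have "\<Psi> p (map ?t us) = (\<lambda>_. 0)"
      using am ts unfolding alternating_multilinear_def by (auto simp: image_subset_iff)
    then show "loc A \<Psi> c x us = 0" by (simp add: loc_def p_def)
  qed
qed

lemma alt_mult_conj:
  assumes "alt_mult k F" "linear P" "linear Q"
  shows "alt_mult k (\<lambda>us. P (F (map Q us)))"
  using assms unfolding alt_mult_def by (auto simp: map_update linear_add linear_scale linear_0)

lemma smooth_on_D_compose:
  assumes "smooth_on V G" "smooth_on W h" "\<And>x. x \<in> V \<Longrightarrow> G x \<in> W" "smooth_on V u"
  shows "smooth_on V (\<lambda>x. D h (G x) (u x))"
proof (rule smooth_on_cong)
  show "smooth_on V (\<lambda>x. \<Sum>b\<in>Basis. (u x \<bullet> b) *\<^sub>R D h (G x) b)"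
  proof (rule smooth_on_sum[OF smooth_onD(1)[OF assms(1)]])
    show "smooth_on V (\<lambda>x. (u x \<bullet> b) *\<^sub>R D h (G x) b)" for b
      by (rule smooth_on_scaleR[OF smooth_on_coordinate[OF assms(4)]
        smooth_on_compose[OF assms(1) smooth_on_D_const[OF assms(2)] assms(3)]])
  qed
  show "(\<Sum>b\<in>Basis. (u x \<bullet> b) *\<^sub>R D h (G x) b) = D h (G x) (u x)" if "x \<in> V" for x
    by (rule linear_basis_expand[symmetric, OF D_linear[OF smooth_on_differentiable[OF assms(2) assms(3)[OF that]]]])
qed

section \<open>Pulling back forms\<close>

text \<open>
  A diffeomorphism \<open>f\<close> of \<open>N\<close> onto an open part of \<open>A\<close>, with inverse \<open>g\<close>.  The last condition says
  that each value of \<open>f\<close> has a chart inside the image in which \<open>f\<close> and \<open>g\<close> are smooth;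
  elsewhere \<open>g\<close> is arbitrary.
\<close>

locale diffeo_onto_open =
  fixes N :: "('b, 'e::euclidean_space) chart set" and A :: "('a, 'e) chart set"
    and f :: "'b \<Rightarrow> 'a" and g :: "'a \<Rightarrow> 'b"
  assumes N: "smooth_atlas N" and A: "smooth_atlas A"
    and gf: "\<And>q. q \<in> points N \<Longrightarrow> g (f q) = q"
    and chart: "\<And>d q. d \<in> charts N \<Longrightarrow> q \<in> points N \<Longrightarrow> \<exists>e\<in>charts A. f q \<in> fst e \<and> smooth_rep d e f
      \<and> smooth_rep e d g \<and> (\<forall>y\<in>fst e. f (g y) = y)"
begin

lemma rep_inverse:
  assumes d: "d \<in> charts N" "q \<in> fst d" and e: "e \<in> charts A" "f q \<in> fst e" "smooth_rep d e f"
    "smooth_rep e d g" "\<forall>y\<in>fst e. f (g y) = y"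
  shows "D (coord_rep e d g) (snd e (f q)) (D (coord_rep d e f) (snd d q) u) = u"
    and "D (coord_rep d e f) (snd d q) (D (coord_rep e d g) (snd e (f q)) w) = w"
proof -
  have q: "q \<in> points N" using d chartsD(2) by blast
  have gq: "g (f q) = q" by (rule gf[OF q])
  have id: "is_chart d" and ie: "is_chart e" using d e chartsD(1) by blast+
  have "D (coord_rep d d (\<lambda>x. g (f x))) (snd d q) = D (coord_rep d d (\<lambda>x. x)) (snd d q)"
  proof (rule D_cong(1)[OF chartsD(3)[OF d(1)]])
    fix x assume x: "x \<in> chart_image d"
    have "chart_inv d x \<in> points N" using chart_chart_inv(2)[OF x] chartsD(2)[OF d(1)] by blast
    then show "coord_rep d d (\<lambda>x. g (f x)) x = coord_rep d d (\<lambda>x. x) x" by (simp add: gf)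
  qed (simp add: chart_image_def d(2))
  then show "D (coord_rep e d g) (snd e (f q)) (D (coord_rep d e f) (snd d q) u) = u"
    using D_coord_rep_compose(1)[OF id ie e(3,4) d(2) e(2), of u] gq d(2) D_transition_self[OF d] by simp
  have "D (coord_rep e e (\<lambda>x. f (g x))) (snd e (f q)) = D (coord_rep e e (\<lambda>x. x)) (snd e (f q))"
  proof (rule D_cong(1)[OF chartsD(3)[OF e(1)]])
    fix x assume x: "x \<in> chart_image e"
    show "coord_rep e e (\<lambda>x. f (g x)) x = coord_rep e e (\<lambda>x. x) x"
      using e(5) chart_chart_inv(2)[OF x] by simp
  qed (simp add: chart_image_def e(2))
  then show "D (coord_rep d e f) (snd d q) (D (coord_rep e d g) (snd e (f q)) w) = w"
    using D_coord_rep_compose(1)[OF ie id e(4,3) e(2), of w] gq d(2) e(2) D_transition_self[OF e(1,2)] by simp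
qed

text \<open>
  The inverse of the differential, taken on the whole tangent space, is the derivative of the
  representative of \<open>g\<close>: the differential is injective by \<open>rep_inverse\<close>, so it is enough to exhibit
  a preimage.
\<close>

lemma inv_into_dmap:
  assumes d: "d \<in> charts N" "q \<in> fst d" and e: "e \<in> charts A" "f q \<in> fst e" "smooth_rep d e f"
    "smooth_rep e d g" "\<forall>y\<in>fst e. f (g y) = y"
    and w: "w \<in> tspace A (f q)"
  shows "inv_into (tspace N q) (dmap N A f q) w = tvec_of N d q (D (coord_rep e d g) (snd e (f q)) (w e))" (is "_ = ?u")
proof -
  have dq: "d \<in> charts_at N q" and ef: "e \<in> charts_at A (f q)" using d e by (auto simp: charts_at_iff)
  have dm: "dmap N A f q v = tvec_of A e (f q) (D (coord_rep d e f) (snd d q) (v d))" if "v \<in> tspace N q" for v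
    by (rule dmap_eq_tvec_of[OF N A dq ef e(3) that])
  have u: "?u \<in> tspace N q" by (rule tvec_of_tspace[OF N dq])
  have "dmap N A f q ?u = tvec_of A e (f q) (w e)"
    by (simp add: dm[OF u] tvec_of_self[OF dq] rep_inverse(2)[OF d e])
  then have fu: "dmap N A f q ?u = w" by (simp add: tvec_of_coord[OF A ef w])
  have inj: "inj_on (dmap N A f q) (tspace N q)"
  proof (rule inj_onI)
    fix v v' assume v: "v \<in> tspace N q" "v' \<in> tspace N q" "dmap N A f q v = dmap N A f q v'"
    then have "D (coord_rep d e f) (snd d q) (v d) = D (coord_rep d e f) (snd d q) (v' d)"
      using dm tvec_of_self[OF ef] by metis
    then have "v d = v' d" using rep_inverse(1)[OF d e] by metis
    then show "v = v'" by (rule tspace_eqI[OF v(1,2) dq])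
  qed
  then show ?thesis using inv_into_f_f[OF inj u] fu by simp
qed

lemma dmap_tspace:
  assumes q: "q \<in> points N" and v: "v \<in> tspace N q"
  shows "dmap N A f q v \<in> tspace A (f q)" "inv_into (tspace N q) (dmap N A f q) (dmap N A f q v) = v"
proof -
  obtain d where d: "d \<in> charts N" "q \<in> fst d"
    using q atlas_subset_charts[OF N] by (auto simp: points_def)
  obtain e where e: "e \<in> charts A" "f q \<in> fst e" "smooth_rep d e f"
    "smooth_rep e d g" "\<forall>y\<in>fst e. f (g y) = y" using chart[OF d(1) q] by blast
  have dq: "d \<in> charts_at N q" and ef: "e \<in> charts_at A (f q)" using d e by (auto simp: charts_at_iff)
  have dm: "dmap N A f q v = tvec_of A e (f q) (D (coord_rep d e f) (snd d q) (v d))"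
    by (rule dmap_eq_tvec_of[OF N A dq ef e(3) v])
  show t: "dmap N A f q v \<in> tspace A (f q)" unfolding dm by (rule tvec_of_tspace[OF A ef])
  show "inv_into (tspace N q) (dmap N A f q) (dmap N A f q v) = v"
    unfolding inv_into_dmap[OF d e t] by (simp add: dm tvec_of_self[OF ef] rep_inverse(1)[OF d e] tvec_of_coord[OF N dq v])
qed

text \<open>
  Let $G$ and $h$ represent \<open>f\<close> and \<open>g\<close> in charts, and let $F$ be the coordinate expression of
  \<open>\<Psi>\<close>.  The pullback has the coordinate expression
  $D h(G(x))\,F(G(x))(D G(x)u_1,\dots,D G(x)u_k)$, in which the
  arguments of $F$ depend on \<open>x\<close>, whence the use of \<open>multilinear_smooth\<close>.
\<close>

lemma local_form_pullback:
  assumes \<Psi>: "\<Psi> \<in> tforms A k" and d: "d \<in> charts N"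
  shows "local_form (chart_image d) k (loc N (pullback N A f \<Psi>) d)"
proof -
  have main: "\<exists>V. x0 \<in> V \<and> V \<subseteq> chart_image d \<and> local_form V k (loc N (pullback N A f \<Psi>) d)"
    if x0: "x0 \<in> chart_image d" for x0
  proof -
    have q0: "chart_inv d x0 \<in> points N" using chart_chart_inv(2)[OF x0] chartsD(2)[OF d] by blast
    obtain e where e: "e \<in> charts A" "f (chart_inv d x0) \<in> fst e" "smooth_rep d e f"
      "smooth_rep e d g" "\<forall>y\<in>fst e. f (g y) = y" using chart[OF d q0] by blast
    define V where "V = snd d ` {q \<in> fst d. f q \<in> fst e}"
    define W where "W = snd e ` {y \<in> fst e. g y \<in> fst d}"
    let ?G = "coord_rep d e f" let ?h = "coord_rep e d g"
    have Gs: "smooth_on V ?G" and hs: "smooth_on W ?h" using e by (auto simp: V_def W_def smooth_rep_def)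
    have V: "open V" by (rule smooth_onD(1)[OF Gs])
    have x0V: "x0 \<in> V" using chart_chart_inv[OF x0] e(2) unfolding V_def by force
    have Vd: "V \<subseteq> chart_image d" by (auto simp: V_def chart_image_def)
    have q: "chart_inv d x \<in> fst d" "f (chart_inv d x) \<in> fst e" "snd d (chart_inv d x) = x" if "x \<in> V" for x
      using that chart_inv_chart[OF chartsD(1)[OF d]] by (auto simp: V_def)
    have GW: "?G x \<in> W" if "x \<in> V" for x
    proof -
      have "g (f (chart_inv d x)) = chart_inv d x" using q(1)[OF that] chartsD(2)[OF d] gf by blast
      then show ?thesis using q[OF that] by (force simp: W_def)
    qed
    have We: "W \<subseteq> chart_image e" by (auto simp: W_def chart_image_def)
    let ?F = "loc A \<Psi> e"
    have F: "local_form (chart_image e) k ?F" by (rule local_form_loc[OF A \<Psi> e(1)])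
    let ?R = "\<lambda>x us. D ?h (?G x) (?F (?G x) (map (D ?G x) us))"
    have eq: "?R x us = loc N (pullback N A f \<Psi>) d x us" if x: "x \<in> V" and us: "length us = k" for x us
    proof -
      define p where "p = chart_inv d x"
      have p: "p \<in> fst d" "f p \<in> fst e" "snd d p = x" using q[OF x] by (auto simp: p_def)
      have dp: "d \<in> charts_at N p" and ep: "e \<in> charts_at A (f p)" using d e p by (auto simp: charts_at_iff)
      have "dmap N A f p (tvec_of N d p u) = tvec_of A e (f p) (D ?G x u)" for u
        using dmap_eq_tvec_of[where f = f, OF N A dp ep e(3) tvec_of_tspace[OF N dp]] by (simp add: tvec_of_self[OF dp] p(3))
      then have m: "map (dmap N A f p) (map (tvec_of N d p) us) = map (tvec_of A e (f p)) (map (D ?G x) us)" by simp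
      have "f p \<in> points A" using e(1) p(2) chartsD(2) by blast
      then have "\<Psi> (f p) (map (tvec_of A e (f p)) (map (D ?G x) us)) \<in> tspace A (f p)"
        using \<Psi> us tvec_of_tspace[OF A ep] unfolding tforms_def alternating_multilinear_def
        by (auto simp: image_subset_iff)
      note inv_into_dmap[OF d p(1) e(1) p(2) e(3-5) this]
      moreover have "chart_inv e (snd e (f p)) = f p" by (rule chart_inv_chart[OF chartsD(1)[OF e(1)] p(2)])
      ultimately show ?thesis
        unfolding loc_def pullback_def p_def[symmetric] m by (simp only: tvec_of_self[OF dp])
    qed
    have "local_form V k ?R"
      unfolding local_form_def
    proof (intro conjI ballI allI impI)
      show "open V" by (rule V)
      show "alt_mult k (?R x)" if "x \<in> V" for x
        using that GW We Gs hs
        by (intro alt_mult_conj local_formD(2)[OF F] D_linear) (auto intro: smooth_on_differentiable)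
      fix us :: "'e list" assume us: "length us = k"
      have "smooth_on V (\<lambda>x. ?F (?G x) (map (\<lambda>i. D ?G x (us ! i)) [0..<k]))"
      proof (rule multilinear_smooth[OF V])
        show "linear (\<lambda>v. ?F (?G x) (us[i := v]))" if "x \<in> V" "length us = k" "i < k" for x us i
          using alt_mult_linear_slot[OF local_formD(2)[OF F]] that GW We by blast
        show "smooth_on V (\<lambda>x. ?F (?G x) us)" if "length us = k" for us
          using smooth_on_compose[OF Gs local_formD(3)[OF F that]] GW We by blast
        show "smooth_on V (\<lambda>x. D ?G x (us ! i))" for i by (rule smooth_on_D_const[OF Gs])
      qed
      moreover have "map (\<lambda>i. h (us ! i)) [0..<k] = map h us" for h :: "'e \<Rightarrow> 'e"
        using us by (intro nth_equalityI) auto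
      ultimately have "smooth_on V (\<lambda>x. ?F (?G x) (map (D ?G x) us))" by simp
      then show "smooth_on V (\<lambda>x. ?R x us)" by (rule smooth_on_D_compose[OF Gs hs GW, rotated])
    qed
    then have "local_form V k (loc N (pullback N A f \<Psi>) d)" by (rule local_form_cong) (rule eq)
    then show ?thesis using x0V Vd by blast
  qed
  show ?thesis
    unfolding local_form_def
  proof (intro conjI ballI allI impI)
    show "open (chart_image d)" by (rule chartsD(3)[OF d])
    show "alt_mult k (loc N (pullback N A f \<Psi>) d x)" if "x \<in> chart_image d" for x
      using main[OF that] local_formD(2) by blast
    show "smooth_on (chart_image d) (\<lambda>x. loc N (pullback N A f \<Psi>) d x us)" if "length us = k" for us
    proof (rule smooth_on_local)
      fix x assume "x \<in> chart_image d"
      from main[OF this] obtain V where V: "x \<in> V" "V \<subseteq> chart_image d" "local_form V k (loc N (pullback N A f \<Psi>) d)"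
        by blast
      then show "\<exists>U. x \<in> U \<and> U \<subseteq> chart_image d \<and> smooth_on U (\<lambda>x. loc N (pullback N A f \<Psi>) d x us)"
        using local_formD(3)[OF V(3) that] by blast
    qed
  qed
qed

end

section \<open>The normal bundle as a manifold\<close>

lemma linear_tpart: "linear (tpart B)"
  by (rule linearI) (simp_all add: tpart_def inner_add_left scaleR_add_left sum.distrib scaleR_sum_right)

lemma linear_npart: "linear (npart B)"
  by (rule linearI) (simp_all add: npart_def inner_add_left scaleR_add_left sum.distrib scaleR_sum_right)

lemma tpart_plus_npart: "B \<subseteq> Basis \<Longrightarrow> tpart B x + npart B x = x"
proof -
  assume B: "B \<subseteq> Basis"
  have "tpart B x + npart B x = (\<Sum>b\<in>Basis. (x \<bullet> b) *\<^sub>R b)"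
    unfolding tpart_def npart_def using sum.subset_diff[OF B finite_Basis] by (metis add.commute)
  then show ?thesis by (simp add: euclidean_representation)
qed

lemma npart_tpart: "B \<subseteq> Basis \<Longrightarrow> npart B (tpart B x) = 0"
  unfolding npart_def tpart_def
  by (rule sum.neutral) (auto simp: inner_sum_left inner_Basis subset_iff intro!: sum.neutral)

lemma tpart_npart: "B \<subseteq> Basis \<Longrightarrow> tpart B (npart B x) = 0"
  unfolding npart_def tpart_def
  by (rule sum.neutral) (auto simp: inner_sum_left inner_Basis subset_iff intro!: sum.neutral)

lemma npart_zero_iff: "B \<subseteq> Basis \<Longrightarrow> npart B x = 0 \<longleftrightarrow> tpart B x = x"
  using tpart_plus_npart[of B x] npart_tpart[of B x] by auto

lemma npart_npart: "B \<subseteq> Basis \<Longrightarrow> npart B (npart B x) = npart B x"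
  using tpart_plus_npart[of B "npart B x"] tpart_npart[of B x] by simp

lemma has_derivative_tpart: "(tpart B has_derivative tpart B) (at x)"
  using linear_tpart[of B] by (simp add: linear_conv_bounded_linear bounded_linear_imp_has_derivative)

lemma open_tpart_vimage: "open T \<Longrightarrow> open (tpart B -` T)"
  by (rule open_vimage)
    (auto intro: has_derivative_continuous[OF has_derivative_tpart] continuous_at_imp_continuous_on)

text \<open>
  Maps that agree on the span of \<open>B\<close> have the same derivative along it, as
  composing them with the projection \<open>tpart B\<close> gives the same map.  With slice charts, this
  transfers identities on \<open>L\<close> to derivatives in directions tangent to \<open>L\<close>.
\<close>

lemma D_eq_on_tangent:
  assumes "open T" "x \<in> T" "tpart B x = x" "tpart B u = u"
    and f: "f differentiable (at x)" and g: "g differentiable (at x)"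
    and eq: "\<And>y. y \<in> T \<Longrightarrow> tpart B y = y \<Longrightarrow> f y = g y"
    and B: "B \<subseteq> Basis"
  shows "D f x u = D g x u"
proof -
  have t: "tpart B differentiable (at x)" "D (tpart B) x u = u"
    using has_derivative_tpart[of B x] D_eqI[OF has_derivative_tpart[of B x]] assms(4)
    by (auto simp: differentiable_def)
  have tt: "tpart B (tpart B y) = tpart B y" for y
    using npart_tpart[OF B] npart_zero_iff[OF B] by blast
  have *: "D (\<lambda>y. h (tpart B y)) x u = D h x u" if "h differentiable (at x)" for h :: "'a \<Rightarrow> 'b"
    using D_compose[OF t(1), of h u] that t(2) assms(3) by simp
  have "D (\<lambda>y. f (tpart B y)) x = D (\<lambda>y. g (tpart B y)) x"
    by (rule D_cong(1)[OF open_tpart_vimage[OF assms(1)]]) (use assms(2,3) eq tt in auto)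
  then show ?thesis using *[OF f] *[OF g] by metis
qed

locale slice_submanifold =
  fixes A :: "('a, 'e::euclidean_space) chart set" and B :: "'e set" and L :: "'a set"
  assumes A: "smooth_atlas A" and B: "B \<subseteq> Basis" and L: "submanifold A B L"
begin

abbreviation "S \<equiv> slice_charts A B L"
abbreviation "N \<equiv> natlas A B L"
abbreviation "nc \<equiv> nchart A B L"

lemma slice_charts: "c \<in> S \<Longrightarrow> c \<in> charts A"
  by (simp add: slice_charts_def)

lemma slice_charts_at: "c \<in> slice_charts_at A B L p \<longleftrightarrow> c \<in> S \<and> p \<in> fst c"
  by (simp add: slice_charts_at_def)

lemma slice_at_charts_at: "c \<in> slice_charts_at A B L p \<Longrightarrow> c \<in> charts_at A p"
  by (simp add: slice_charts_at slice_charts charts_at_iff)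

lemma slice_iff:
  assumes c: "c \<in> S" and p: "p \<in> fst c"
  shows "p \<in> L \<longleftrightarrow> tpart B (snd c p) = snd c p"
proof -
  have im: "snd c ` (fst c \<inter> L) = {x \<in> chart_image c. npart B x = 0}" using c by (simp add: slice_charts_def)
  have inj: "inj_on (snd c) (fst c)" using chartsD(1)[OF slice_charts[OF c]] by (simp add: is_chart_def)
  have "p \<in> L \<longleftrightarrow> snd c p \<in> snd c ` (fst c \<inter> L)" using inj p by (auto dest: inj_onD)
  also have "\<dots> \<longleftrightarrow> npart B (snd c p) = 0" unfolding im using p by (simp add: chart_image_def)
  finally show ?thesis by (simp add: npart_zero_iff[OF B])
qed

lemma tpart_tpart: "tpart B (tpart B x) = tpart B x"
  using npart_tpart[OF B] npart_zero_iff[OF B] by blast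

lemma slice_inv:
  assumes "c \<in> S" "tpart B x \<in> chart_image c"
  shows "chart_inv c (tpart B x) \<in> L" "chart_inv c (tpart B x) \<in> fst c" "snd c (chart_inv c (tpart B x)) = tpart B x"
  using chart_chart_inv[OF assms(2)] slice_iff[OF assms(1), of "chart_inv c (tpart B x)"] tpart_tpart by auto

lemma slice_chart_exists:
  assumes "p \<in> L" obtains c where "c \<in> slice_charts_at A B L p"
  using L assms unfolding submanifold_def by blast

lemma transition_open:
  assumes "c \<in> S" "c' \<in> charts A"
  shows "open (snd c ` {p \<in> fst c. p \<in> fst c'})"
  using charts_smooth_rep[OF A slice_charts[OF assms(1)] assms(2)] by (auto simp: smooth_rep_def dest: smooth_onD)

text \<open>
  The transition between two slice charts maps the slice to the slice.
\<close>

lemma transition_tangent: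
  assumes c: "c \<in> S" "p \<in> fst c" and c': "c' \<in> S" "p \<in> fst c'" and p: "p \<in> L" and u: "npart B u = 0"
  shows "npart B (D (coord_rep c c' (\<lambda>x. x)) (snd c p) u) = 0"
proof -
  let ?t = "coord_rep c c' (\<lambda>x. x)"
  have diff: "?t differentiable (at (snd c p))"
    by (rule smooth_rep_differentiable[OF charts_smooth_rep[OF A]]) (use c c' slice_charts in auto)
  have "((\<lambda>x. npart B (?t x)) has_derivative (\<lambda>v. npart B (D ?t (snd c p) v))) (at (snd c p))"
    using linear_npart by (intro bounded_linear.has_derivative[OF _ D_has[OF diff]]) (simp add: linear_conv_bounded_linear)
  then have "(\<lambda>x. npart B (?t x)) differentiable (at (snd c p))"
    and eq: "D (\<lambda>x. npart B (?t x)) (snd c p) u = npart B (D ?t (snd c p) u)"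
    by (auto simp: differentiable_def intro: D_eqI)
  then have "D (\<lambda>x. npart B (?t x)) (snd c p) u = D (\<lambda>x. 0 :: 'e) (snd c p) u"
  proof (intro D_eq_on_tangent[OF transition_open[OF c(1) slice_charts[OF c'(1)]]])
    show "tpart B (snd c p) = snd c p" using slice_iff[OF c] p by simp
    show "tpart B u = u" using u npart_zero_iff[OF B] by simp
    fix y assume y: "y \<in> snd c ` {p \<in> fst c. p \<in> fst c'}" "tpart B y = y"
    then obtain p' where p': "y = snd c p'" "p' \<in> fst c" "p' \<in> fst c'" by auto
    then have "p' \<in> L" using slice_iff[OF c(1)] y by simp
    then show "npart B (?t y) = 0"
      using p' slice_iff[OF c'(1)] npart_zero_iff[OF B] chart_inv_chart[OF chartsD(1)[OF slice_charts[OF c(1)]]] by simp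
  qed (use c c' B in auto)
  then show ?thesis using eq by (simp add: frechet_derivative_const)
qed

lemma nfibreD:
  assumes "w \<in> nfibre A B L p" 
  shows "npart B (w c) = w c" "tpart B (w c) = 0" "c \<notin> slice_charts_at A B L p \<Longrightarrow> w c = 0"
proof -
  show "npart B (w c) = w c"
    using assms npart_npart[OF B] linear_0[OF linear_npart] by (auto simp: nfibre_def nproj_def)
  then show "tpart B (w c) = 0" using tpart_npart[OF B] by metis
  show "c \<notin> slice_charts_at A B L p \<Longrightarrow> w c = 0" using assms by (auto simp: nfibre_def nproj_def)
qed

text \<open>
  The coordinates of a normal vector in another slice chart can be computed from any lift \<open>u\<close> to
  the tangent space, since lifts differ by vectors tangent to \<open>L\<close>, which stay tangent to \<open>L\<close>.
\<close>

lemma nfibre_transition: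
  assumes w: "w \<in> nfibre A B L p" and p: "p \<in> L"
    and c: "c \<in> slice_charts_at A B L p" and c': "c' \<in> slice_charts_at A B L p" and u: "npart B u = w c"
  shows "w c' = npart B (D (coord_rep c c' (\<lambda>x. x)) (snd c p) u)"
proof -
  obtain v where v: "v \<in> tspace A p" "w = nproj A B L p v" using w by (auto simp: nfibre_def)
  have lin: "linear (D (coord_rep c c' (\<lambda>x. x)) (snd c p))"
    by (rule D_transition_linear[OF A slice_at_charts_at[OF c] slice_at_charts_at[OF c']])
  have "npart B (v c - u) = 0" using v u c by (simp add: linear_diff[OF linear_npart] nproj_def)
  then have "npart B (D (coord_rep c c' (\<lambda>x. x)) (snd c p) (v c - u)) = 0"
    using c c' p by (intro transition_tangent) (auto simp: slice_charts_at)
  moreover have "w c' = npart B (D (coord_rep c c' (\<lambda>x. x)) (snd c p) (v c))"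
    using tspaceD[OF v(1) slice_at_charts_at[OF c] slice_at_charts_at[OF c']] v(2) c' by (simp add: nproj_def)
  ultimately show ?thesis by (simp add: linear_diff[OF lin] linear_diff[OF linear_npart])
qed

lemma nfibre_eqI:
  assumes "w \<in> nfibre A B L p" "w' \<in> nfibre A B L p" "p \<in> L" "c \<in> slice_charts_at A B L p" "w c = w' c"
  shows "w = w'"
proof
  fix c' show "w c' = w' c'"
    using nfibre_transition[OF assms(1,3,4), of c' "w c"] nfibre_transition[OF assms(2,3,4), of c' "w c"]
      nfibreD(1,3)[OF assms(1)] nfibreD(1,3)[OF assms(2)] assms(5)
    by (cases "c' \<in> slice_charts_at A B L p") auto
qed

lemma fst_nc: "q \<in> fst (nc c) \<longleftrightarrow> fst q \<in> L \<and> snd q \<in> nfibre A B L (fst q) \<and> fst q \<in> fst c"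
  by (auto simp: nchart_def ntotal_def)

lemma snd_nc: "snd (nc c) q = snd c (fst q) + snd q c"
  by (simp add: nchart_def case_prod_beta)

lemma nc_parts:
  assumes "c \<in> S" "q \<in> fst (nc c)"
  shows "tpart B (snd (nc c) q) = snd c (fst q)" "npart B (snd (nc c) q) = snd q c"
proof -
  have "tpart B (snd c (fst q)) = snd c (fst q)" "npart B (snd c (fst q)) = 0"
    using slice_iff[OF assms(1), of "fst q"] assms(2) npart_zero_iff[OF B] by (auto simp: fst_nc)
  then show "tpart B (snd (nc c) q) = snd c (fst q)" "npart B (snd (nc c) q) = snd q c"
    using nfibreD[of "snd q" "fst q" c] assms(2)
    by (auto simp: snd_nc fst_nc linear_add[OF linear_tpart] linear_add[OF linear_npart])
qed

text \<open>
  The point of $NL$ with coordinates \<open>x\<close>: the tangential part of \<open>x\<close> gives the base point, and the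
  class of the tangent vector with coordinates \<open>x\<close> has the normal part of \<open>x\<close> as fibre
  coordinates.
\<close>

lemma nc_inverse_point:
  assumes c: "c \<in> S" and x: "tpart B x \<in> chart_image c"
  defines "p \<equiv> chart_inv c (tpart B x)"
  defines "q \<equiv> (p, nproj A B L p (tvec_of A c p x))"
  shows "q \<in> fst (nc c)" "snd (nc c) q = x"
proof -
  have p: "p \<in> L" "p \<in> fst c" "snd c p = tpart B x" using slice_inv[OF c x] by (auto simp: p_def)
  have cp: "c \<in> slice_charts_at A B L p" using c p by (simp add: slice_charts_at)
  show "q \<in> fst (nc c)"
    using p tvec_of_tspace[OF A slice_at_charts_at[OF cp]] by (auto simp: fst_nc q_def nfibre_def)
  show "snd (nc c) q = x"
    using cp p tpart_plus_npart[OF B, of x]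
    by (simp add: snd_nc q_def nproj_def tvec_of_self[OF slice_at_charts_at[OF cp]])
qed

lemma chart_image_nc:
  assumes c: "c \<in> S" shows "chart_image (nc c) = tpart B -` chart_image c"
proof -
  have "tpart B (snd (nc c) q) \<in> chart_image c" if "q \<in> fst (nc c)" for q
    using nc_parts(1)[OF c that] that by (simp add: chart_image_def fst_nc)
  moreover have "x \<in> snd (nc c) ` fst (nc c)" if "tpart B x \<in> chart_image c" for x
    using nc_inverse_point[OF c that] by (metis image_eqI)
  ultimately show ?thesis unfolding chart_image_def[of "nc c"] by blast
qed

lemma is_chart_nc:
  assumes c: "c \<in> S" shows "is_chart (nc c)"
  unfolding is_chart_def
proof
  show "open (chart_image (nc c))"
    unfolding chart_image_nc[OF c] by (rule open_tpart_vimage[OF chartsD(3)[OF slice_charts[OF c]]])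
  have inj: "inj_on (snd c) (fst c)" using chartsD(1)[OF slice_charts[OF c]] by (simp add: is_chart_def)
  show "inj_on (snd (nc c)) (fst (nc c))"
  proof (rule inj_onI)
    fix q q' assume q: "q \<in> fst (nc c)" "q' \<in> fst (nc c)" "snd (nc c) q = snd (nc c) q'"
    have "snd c (fst q) = snd c (fst q')" "snd q c = snd q' c"
      using nc_parts[OF c q(1)] nc_parts[OF c q(2)] q(3) by auto
    moreover have "fst q = fst q'"
      using inj calculation(1) q by (auto simp: fst_nc dest: inj_onD)
    moreover have "snd q = snd q'"
      using q calculation c by (intro nfibre_eqI[of "snd q" "fst q" "snd q'" c]) (auto simp: fst_nc slice_charts_at)
    ultimately show "q = q'" by (simp add: prod_eq_iff)
  qed
qed

lemma chart_inv_nc: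
  assumes c: "c \<in> S" and x: "tpart B x \<in> chart_image c"
  shows "chart_inv (nc c) x = (chart_inv c (tpart B x),
    nproj A B L (chart_inv c (tpart B x)) (tvec_of A c (chart_inv c (tpart B x)) x))"
  using chart_inv_chart[OF is_chart_nc[OF c] nc_inverse_point(1)[OF c x]] nc_inverse_point(2)[OF c x] by simp

text \<open>
  The transition map of the normal bundle is
  $x \mapsto t(x') + \nu\,(D t(x')\,x)$ with $t$ the transition map of the slice charts, $x'$ the
  tangential part of $x$ and $\nu$ the projection to the normal part.  The tangential part of the
  last $x$ contributes nothing, by \<open>transition_tangent\<close>.
\<close>

lemma nc_smooth_rep:
  assumes c: "c \<in> S" and c': "c' \<in> S"
  shows "smooth_rep (nc c) (nc c') (\<lambda>q. q)"
proof -
  let ?t = "coord_rep c c' (\<lambda>x. x)"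
  let ?T = "snd c ` {p \<in> fst c. p \<in> fst c'}"
  have cc: "c \<in> charts A" "c' \<in> charts A" using c c' slice_charts by auto
  have T: "?T = {x \<in> chart_image c. chart_inv c x \<in> fst c'}" by (rule chart_image_Collect[OF chartsD(1)[OF cc(1)]])
  have op: "open (tpart B -` ?T)" by (rule open_tpart_vimage[OF transition_open[OF c cc(2)]])
  have t: "smooth_on ?T ?t" using charts_smooth_rep[OF A cc] by (simp add: smooth_rep_def)
  have dom: "snd (nc c) ` {q \<in> fst (nc c). q \<in> fst (nc c')} = tpart B -` ?T"
    unfolding chart_image_Collect[OF is_chart_nc[OF c]] T chart_image_nc[OF c]
    using nc_inverse_point(1)[OF c] by (auto simp: chart_inv_nc[OF c] fst_nc)
  have tp: "smooth_on (tpart B -` ?T) (tpart B)" by (rule smooth_on_linear[OF op linear_tpart])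
  have 1: "smooth_on (tpart B -` ?T) (\<lambda>x. ?t (tpart B x))"
    by (rule smooth_on_compose[OF tp t]) auto
  have 2: "smooth_on (tpart B -` ?T) (\<lambda>x. D ?t (tpart B x) x)"
    by (rule smooth_on_D_compose[OF tp t]) (auto intro: smooth_on_linear[OF op] linearI)
  have "smooth_on (tpart B -` ?T) (\<lambda>x. ?t (tpart B x) + npart B (D ?t (tpart B x) x))"
    by (rule smooth_on_add[OF 1 smooth_on_linear_compose[OF linear_npart 2]])
  moreover have "?t (tpart B x) + npart B (D ?t (tpart B x) x) = coord_rep (nc c) (nc c') (\<lambda>q. q) x"
    if "x \<in> tpart B -` ?T" for x
  proof -
    have x: "tpart B x \<in> chart_image c" "chart_inv c (tpart B x) \<in> fst c'" using that unfolding T by auto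
    have p: "chart_inv c (tpart B x) \<in> fst c" "snd c (chart_inv c (tpart B x)) = tpart B x"
      using slice_inv[OF c x(1)] by auto
    show ?thesis
      using x p c c' cc by (simp add: chart_inv_nc[OF c] snd_nc nproj_def slice_charts_at tvec_of_def charts_at_iff)
  qed
  ultimately show ?thesis unfolding smooth_rep_def dom by (rule smooth_on_cong)
qed

lemma smooth_atlas_natlas: "smooth_atlas N"
  by (auto simp: smooth_atlas_def natlas_def compatible_iff is_chart_nc nc_smooth_rep)

lemma points_natlas: "points N = ntotal A B L"
proof -
  have "\<exists>c\<in>S. p \<in> fst c" if "p \<in> L" for p
    using L that by (force simp: submanifold_def slice_charts_at_def)
  then show ?thesis by (force simp: points_def natlas_def nchart_def ntotal_def)
qed

lemma nc_charts: "c \<in> S \<Longrightarrow> nc c \<in> charts N"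
  using atlas_subset_charts[OF smooth_atlas_natlas] by (auto simp: natlas_def)

section \<open>The zero section\<close>

lemma zero_in_nfibre:
  assumes p: "p \<in> L" shows "(\<lambda>_. 0) \<in> nfibre A B L p"
proof -
  obtain c where c: "c \<in> slice_charts_at A B L p" by (rule slice_chart_exists[OF p])
  let ?v = "tvec_of A c p 0"
  have "?v = (\<lambda>_. 0)"
    using D_transition_linear[OF A slice_at_charts_at[OF c]] by (auto simp: tvec_of_def linear_0)
  then have "nproj A B L p ?v = (\<lambda>_. 0)" by (auto simp: nproj_def linear_0[OF linear_npart])
  then show ?thesis using tvec_of_tspace[OF A slice_at_charts_at[OF c], of 0] by (force simp: nfibre_def)
qed

lemma zero_section_nc: "p \<in> L \<Longrightarrow> p \<in> fst c \<Longrightarrow> zero_section p \<in> fst (nc c)"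
  "snd (nc c) (zero_section p) = snd c p"
  by (auto simp: fst_nc snd_nc zero_section_def zero_in_nfibre)

lemma zero_section_charts_at:
  "p \<in> L \<Longrightarrow> c \<in> slice_charts_at A B L p \<Longrightarrow> nc c \<in> charts_at N (zero_section p)"
  by (simp add: charts_at_iff nc_charts zero_section_nc slice_charts_at)

lemma tsubD:
  assumes "v \<in> tsub A B L p" "c \<in> slice_charts_at A B L p"
  shows "v \<in> tspace A p" "tpart B (v c) = v c" "npart B (v c) = 0"
  using assms npart_zero_iff[OF B] by (auto simp: tsub_def)

text \<open>
  In the chart \<open>nchart A B L c\<close>, the zero section has the same coordinates as \<open>L\<close> in the chart \<open>c\<close>.
  Thus a map \<open>f\<close> on $NL$ extending a map on \<open>L\<close> and a map \<open>g\<close> on the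
  ambient manifold extending the same map have the same derivative along \<open>L\<close>.
\<close>

lemma D_at_zero_section:
  fixes f :: "'a \<times> ('a, 'e) tvec \<Rightarrow> 'b" and g :: "'a \<Rightarrow> 'b" and e :: "('b, 'f::euclidean_space) chart"
  assumes p: "p \<in> L" and c: "c \<in> slice_charts_at A B L p" and v: "v \<in> tsub A B L p"
    and f: "coord_rep (nc c) e f differentiable (at (snd c p))"
    and g: "coord_rep c e g differentiable (at (snd c p))"
    and T: "open T" "snd c p \<in> T" "T \<subseteq> chart_image c"
    and eq: "\<And>p. p \<in> L \<Longrightarrow> snd c p \<in> T \<Longrightarrow> f (zero_section p) = g p"
  shows "D (coord_rep (nc c) e f) (snd c p) (v c) = D (coord_rep c e g) (snd c p) (v c)"
proof (rule D_eq_on_tangent[OF T(1,2) _ tsubD(2)[OF v c] f g _ B])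
  have cS: "c \<in> S" "p \<in> fst c" using c by (auto simp: slice_charts_at)
  have ch: "is_chart c" using chartsD(1) slice_charts cS by blast
  show "tpart B (snd c p) = snd c p" using slice_iff[OF cS] p by simp
  fix y assume y: "y \<in> T" "tpart B y = y"
  then obtain p' where p': "y = snd c p'" "p' \<in> fst c" using T(3) by (auto simp: chart_image_def)
  then have p'L: "p' \<in> L" using slice_iff[OF cS(1)] y by simp
  have "chart_inv (nc c) y = zero_section p'"
    using chart_inv_chart[OF is_chart_nc[OF cS(1)] zero_section_nc(1)[OF p'L p'(2)]] p'(1) by (simp add: zero_section_nc(2))
  then show "coord_rep (nc c) e f y = coord_rep c e g y"
    using chart_inv_chart[OF ch p'(2)] eq[OF p'L] y p' by simp
qed

text \<open>
  A vector tangent to \<open>L\<close> and its image under the differential of the zero section have the same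
  coordinates in the charts given by a slice chart, whichever slice chart is used.
\<close>

lemma dzero_eq:
  assumes p: "p \<in> L" and c: "c \<in> slice_charts_at A B L p" and v: "v \<in> tsub A B L p"
  shows "dzero A B L p v = tvec_of N (nc c) (zero_section p) (v c)"
proof -
  let ?q = "zero_section p"
  define c' where "c' = (SOME c. c \<in> slice_charts_at A B L p)"
  have c': "c' \<in> slice_charts_at A B L p" unfolding c'_def using c by (rule someI)
  have cS: "c' \<in> S" "p \<in> fst c'" "c \<in> S" "p \<in> fst c" using c c' by (auto simp: slice_charts_at)
  have tp: "tpart B (snd c' p) = snd c' p" using slice_iff[OF cS(1,2)] p by simp
  have nq: "nc c' \<in> charts_at N ?q" "nc c \<in> charts_at N ?q" using zero_section_charts_at p c c' by auto
  have "dzero A B L p v d = tvec_of N (nc c') ?q (v c') d" for d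
  proof (cases "d \<in> charts_at N ?q")
    case d: True
    let ?t = "coord_rep (nc c') d (\<lambda>q. q)"
    have dt: "?t differentiable (at (tpart B (snd c' p)))"
      unfolding tp using smooth_rep_differentiable[OF charts_smooth_rep[OF smooth_atlas_natlas], of "nc c'" d ?q] d nq
      by (simp add: charts_at_iff zero_section_nc)
    have "D (\<lambda>x. snd d (zero_section (chart_inv c' (tpart B x)))) (snd c' p) = D (\<lambda>x. ?t (tpart B x)) (snd c' p)"
    proof (rule D_cong(1)[OF open_tpart_vimage[OF chartsD(3)[OF slice_charts[OF cS(1)]]]])
      show "snd c' p \<in> tpart B -` chart_image c'" using tp cS by (simp add: chart_image_def)
      fix x assume "x \<in> tpart B -` chart_image c'"
      then have x: "tpart B x \<in> chart_image c'" by simp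
      note i = slice_inv[OF cS(1) x]
      have "chart_inv (nc c') (tpart B x) = zero_section (chart_inv c' (tpart B x))"
        using chart_inv_chart[OF is_chart_nc[OF cS(1)] zero_section_nc(1)[OF i(1,2)]] i(3) by (simp add: zero_section_nc(2))
      then show "snd d (zero_section (chart_inv c' (tpart B x))) = ?t (tpart B x)" by simp
    qed
    moreover have "D (\<lambda>x. ?t (tpart B x)) (snd c' p) (v c') = D ?t (snd c' p) (v c')"
      using D_eqI[OF has_derivative_compose[OF has_derivative_tpart D_has[OF dt]]] tp tsubD(2)[OF v c'] by simp
    ultimately show ?thesis
      using d by (simp add: dzero_def Let_def c'_def[symmetric] tvec_of_def zero_section_nc(2))
  qed (simp add: dzero_def Let_def tvec_of_def)
  then have "dzero A B L p v = tvec_of N (nc c') ?q (v c')" by blast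
  also have "\<dots> = tvec_of N (nc c) ?q (v c)"
  proof (rule tspace_eqI[OF _ _ nq(2)])
    show "tvec_of N (nc c') ?q (v c') \<in> tspace N ?q" "tvec_of N (nc c) ?q (v c) \<in> tspace N ?q"
      by (rule tvec_of_tspace[OF smooth_atlas_natlas], rule nq)+
    let ?T = "snd c' ` {p \<in> fst c'. p \<in> fst c}"
    have "D (coord_rep (nc c') (nc c) (\<lambda>q. q)) (snd c' p) (v c') = D (coord_rep c' c (\<lambda>p. p)) (snd c' p) (v c')"
    proof -
      have 1: "coord_rep (nc c') (nc c) (\<lambda>q. q) differentiable (at (snd c' p))"
        using smooth_rep_differentiable[OF nc_smooth_rep[OF cS(1,3)], of ?q] zero_section_nc p cS by simp
      have 2: "coord_rep c' c (\<lambda>p. p) differentiable (at (snd c' p))"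
        using smooth_rep_differentiable[OF charts_smooth_rep[OF A], of c' c p] slice_charts cS by simp
      have 3: "coord_rep c' (nc c) zero_section = coord_rep c' c (\<lambda>p. p)"
        by (simp add: zero_section_nc(2))
      show ?thesis
        using D_at_zero_section[OF p c' v 1, of zero_section ?T] 2 transition_open[OF cS(1) slice_charts[OF cS(3)]] cS
        unfolding 3 by (auto simp: chart_image_def)
    qed
    also have "\<dots> = v c"
      using tspaceD[OF tsubD(1)[OF v c] slice_at_charts_at[OF c'] slice_at_charts_at[OF c]] by simp
    finally show "tvec_of N (nc c') ?q (v c') (nc c) = tvec_of N (nc c) ?q (v c) (nc c)"
      unfolding tvec_of_self[OF nq(2)] using nq by (simp add: tvec_of_def zero_section_nc(2))
  qed
  finally show ?thesis .
qed

lemma dzero_tspace: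
  assumes p: "p \<in> L" and v: "v \<in> tsub A B L p"
  shows "dzero A B L p v \<in> tspace N (zero_section p)"
proof -
  obtain c where c: "c \<in> slice_charts_at A B L p" by (rule slice_chart_exists[OF p])
  show ?thesis unfolding dzero_eq[OF p c v]
    by (rule tvec_of_tspace[OF smooth_atlas_natlas zero_section_charts_at[OF p c]])
qed

lemma dzero_coord:
  assumes p: "p \<in> L" and v: "v \<in> tsub A B L p" and c: "c \<in> slice_charts_at A B L p"
  shows "dzero A B L p v (nc c) = v c"
  unfolding dzero_eq[OF p c v] by (rule tvec_of_self[OF zero_section_charts_at[OF p c]])

text \<open>
  As \<open>f\<close> restricts to the inclusion of \<open>L\<close> on the zero section, its differential inverts \<open>dzero\<close>.
\<close>

lemma dmap_dzero:
  assumes f: "diffeo_onto_open N A f g" and f0: "\<And>p. p \<in> L \<Longrightarrow> f (zero_section p) = p"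
    and p: "p \<in> L" and v: "v \<in> tsub A B L p"
  shows "dmap N A f (zero_section p) (dzero A B L p v) = v"
proof -
  interpret f: diffeo_onto_open N A f g by (rule f)
  let ?q = "zero_section p"
  obtain c where c: "c \<in> slice_charts_at A B L p" by (rule slice_chart_exists[OF p])
  have cS: "c \<in> S" "p \<in> fst c" using c by (auto simp: slice_charts_at)
  have nq: "nc c \<in> charts_at N ?q" by (rule zero_section_charts_at[OF p c])
  then have qN: "?q \<in> points N" using chartsD(2) by (fastforce simp: charts_at_iff)
  obtain e where e: "e \<in> charts A" "f ?q \<in> fst e" "smooth_rep (nc c) e f"
    using f.chart[OF nc_charts[OF cS(1)] qN] by blast
  have ep: "e \<in> charts_at A p" "p \<in> fst e" using e f0[OF p] by (auto simp: charts_at_iff)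
  let ?T = "snd c ` {p \<in> fst c. p \<in> fst e}"
  have 1: "coord_rep (nc c) e f differentiable (at (snd c p))"
    using smooth_rep_differentiable[OF e(3), of ?q] zero_section_nc p cS e by simp
  have 2: "coord_rep c e (\<lambda>p. p) differentiable (at (snd c p))"
    using smooth_rep_differentiable[OF charts_smooth_rep[OF A], of c e p] slice_charts cS e ep by simp
  have "dmap N A f ?q (dzero A B L p v) = tvec_of A e (f ?q) (D (coord_rep (nc c) e f) (snd (nc c) ?q) (dzero A B L p v (nc c)))"
    using e f0 p ep by (intro dmap_eq_tvec_of[OF smooth_atlas_natlas A nq _ e(3) dzero_tspace[OF p v]]) simp
  also have "\<dots> = tvec_of A e p (D (coord_rep (nc c) e f) (snd c p) (v c))"
    by (simp add: dzero_coord[OF p v c] f0[OF p] zero_section_nc(2))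
  also have "D (coord_rep (nc c) e f) (snd c p) (v c) = D (coord_rep c e (\<lambda>p. p)) (snd c p) (v c)"
    by (rule D_at_zero_section[OF p c v 1 2 transition_open[OF cS(1) e(1)]])
      (use cS ep f0 in \<open>auto simp: chart_image_def\<close>)
  also have "\<dots> = v e" using tspaceD[OF tsubD(1)[OF v c] slice_at_charts_at[OF c] ep(1)] by simp
  finally show ?thesis by (simp add: tvec_of_coord[OF A ep(1) tsubD(1)[OF v c]])
qed

text \<open>
  The term of order 0 of the exponential series.  By \<open>dmap_dzero\<close>, the pullback of \<open>\<Psi>\<close> takes
  on the zero section the values \<open>dzero w\<close> with \<open>w\<close> a value of \<open>\<Psi>\<close> on vectors tangent to \<open>L\<close>.  Such
  a \<open>w\<close> is tangent to \<open>L\<close>, so \<open>dzero w\<close> has no normal component.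
\<close>

lemma PL_pullback_zero:
  assumes f: "diffeo_onto_open N A f g" and f0: "\<And>p. p \<in> L \<Longrightarrow> f (zero_section p) = p"
    and \<Psi>: "psi_submanifold A B L k \<Psi>"
    and p: "p \<in> L" and vs: "length vs = k" "set vs \<subseteq> tsub A B L p"
  shows "PL A B L (pullback N A f \<Psi>) p vs = (\<lambda>_. 0)"
proof -
  let ?q = "zero_section p"
  define w where "w = \<Psi> p vs"
  have w: "w \<in> tsub A B L p" using \<Psi> p vs by (simp add: psi_submanifold_def w_def)
  have "map (dmap N A f ?q) (map (dzero A B L p) vs) = vs"
    using dmap_dzero[OF f f0 p] vs(2) by (auto simp: map_idI subset_iff)
  then have "pullback N A f \<Psi> ?q (map (dzero A B L p) vs) = inv_into (tspace N ?q) (dmap N A f ?q) w"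
    unfolding pullback_def f0[OF p] by (simp only: w_def)
  also have "\<dots> = inv_into (tspace N ?q) (dmap N A f ?q) (dmap N A f ?q (dzero A B L p w))"
    by (simp only: dmap_dzero[OF f f0 p w])
  also have "\<dots> = dzero A B L p w"
    using p by (intro diffeo_onto_open.dmap_tspace(2)[OF f _ dzero_tspace[OF p w]])
      (simp add: points_natlas ntotal_def zero_section_def zero_in_nfibre)
  finally have "PL A B L (pullback N A f \<Psi>) p vs = normal_component A B L p (dzero A B L p w)"
    by (simp add: PL_def)
  also have "\<dots> = (\<lambda>_. 0)"
    using dzero_coord[OF p w] tsubD(3)[OF w] by (auto simp: normal_component_def)
  finally show ?thesis .
qed

text \<open>
  On sections, \<open>jL\<close> is constant along the fibres, and the velocity of $t \mapsto q + t X$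
  has the coordinates of $X$ in a chart that is linear on the fibres.
\<close>

lemma loc_jL:
  assumes c: "c \<in> S" and x: "x \<in> chart_image (nc c)"
  shows "loc N (jL A B L \<alpha>) (nc c) x [] = loc A \<alpha> c (tpart B x) []"
proof -
  define q where "q = chart_inv (nc c) x"
  have tx: "tpart B x \<in> chart_image c" using x chart_image_nc[OF c] by auto
  have fq: "fst q = chart_inv c (tpart B x)" by (simp add: q_def chart_inv_nc[OF c tx])
  have q: "nc c \<in> charts_at N q"
    using chart_chart_inv(2)[OF x] nc_charts[OF c] by (simp add: q_def charts_at_iff)
  have "((\<lambda>t. snd c (fst q) + (snd q c + t *\<^sub>R \<alpha> (fst q) [] c)) has_vector_derivative \<alpha> (fst q) [] c) (at 0)"
    by (auto intro!: derivative_eq_intros)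
  then have "vector_derivative (\<lambda>t. snd c (fst q) + (snd q c + t *\<^sub>R \<alpha> (fst q) [] c)) (at 0) = \<alpha> (fst q) [] c"
    by (rule vector_derivative_at)
  then have "jL A B L \<alpha> q [] (nc c) = \<alpha> (fst q) [] c"
    using q by (simp add: jL_def vertical_lift_def velocity_def snd_nc)
  then show ?thesis by (simp add: loc_def q_def[symmetric] fq)
qed

lemma smooth_on_loc_jL:
  assumes c: "c \<in> S" and \<alpha>: "\<alpha> \<in> nforms A B L 0"
  shows "smooth_on (chart_image (nc c)) (\<lambda>x. loc N (jL A B L \<alpha>) (nc c) x [])"
proof (rule smooth_on_cong)
  show "smooth_on (chart_image (nc c)) (\<lambda>x. loc A \<alpha> c (tpart B x) [])"
    using \<alpha> c unfolding chart_image_nc[OF c] by (simp add: nforms_def)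
qed (simp add: loc_jL[OF c])

end

section \<open>Brackets and Lie derivatives in a chart\<close>

lemma fn_bracket_in_chart:
  assumes d: "d \<in> charts_at N p" and K: "local_form (chart_image d) k (loc N K d)"
    and X: "smooth_on (chart_image d) (\<lambda>x. loc N X d x [])" and len: "length vs = k"
  shows "fn_bracket N k 0 K X p vs d
    = - local_lie (\<lambda>x. loc N X d x []) (loc N K d) (snd d p) (map (\<lambda>v. v d) vs)"
proof -
  have "snd d p \<in> chart_image d" using d by (simp add: charts_at_iff chart_image_def)
  from fn_on_const_fields[OF K X _ this, of "loc N X d" "map (\<lambda>v. v d) vs"] d len
  show ?thesis by (simp add: fn_bracket_def o_def)
qed

lemma lie_deriv_in_chart:
  assumes d: "d \<in> charts_at N p" and K: "local_form (chart_image d) k (loc N K d)" and len: "length vs = k"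
  shows "lie_deriv N X K p vs d
    = local_lie (\<lambda>x. loc N X d x []) (loc N K d) (snd d p) (map (\<lambda>v. v d) vs)"
proof -
  have "snd d p \<in> chart_image d" using d by (simp add: charts_at_iff chart_image_def)
  from lie_deriv_on_const_fields[OF K this, of "map (\<lambda>v. v d) vs"] d len
  show ?thesis by (simp add: lie_deriv_def o_def)
qed

lemma chart_inv_charts_at: "d \<in> charts N \<Longrightarrow> x \<in> chart_image d \<Longrightarrow> d \<in> charts_at N (chart_inv d x)"
  by (simp add: charts_at_iff chart_chart_inv)

lemma loc_fn_bracket:
  assumes d: "d \<in> charts N" and K: "local_form (chart_image d) k (loc N K d)"
    and X: "smooth_on (chart_image d) (\<lambda>x. loc N X d x [])" and x: "x \<in> chart_image d" and len: "length us = k"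
  shows "loc N (fn_bracket N k 0 K X) d x us = - local_lie (\<lambda>x. loc N X d x []) (loc N K d) x us"
  using fn_bracket_in_chart[OF chart_inv_charts_at[OF d x] K X, of "map (tvec_of N d (chart_inv d x)) us"] len
  by (simp add: loc_def[of N "fn_bracket N k 0 K X"] o_def tvec_of_self[OF chart_inv_charts_at[OF d x]] chart_chart_inv[OF x])

lemma loc_lie_deriv:
  assumes d: "d \<in> charts N" and K: "local_form (chart_image d) k (loc N K d)"
    and x: "x \<in> chart_image d" and len: "length us = k"
  shows "loc N (lie_deriv N X K) d x us = local_lie (\<lambda>x. loc N X d x []) (loc N K d) x us"
  using lie_deriv_in_chart[OF chart_inv_charts_at[OF d x] K, of "map (tvec_of N d (chart_inv d x)) us" X] len
  by (simp add: loc_def[of N "lie_deriv N X K"] o_def tvec_of_self[OF chart_inv_charts_at[OF d x]] chart_chart_inv[OF x])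

section \<open>Power series of iterated Lie derivatives\<close>

text \<open>
  The first element of the list is the index of the innermost Lie derivative, which is the order in which
  \<open>iterated_bracket\<close> consumes its arguments.
\<close>

definition lie_iter ::
  "(nat \<Rightarrow> 'e::euclidean_space \<Rightarrow> 'e) \<Rightarrow> nat list \<Rightarrow> ('e \<Rightarrow> 'e list \<Rightarrow> 'e) \<Rightarrow> 'e \<Rightarrow> 'e list \<Rightarrow> 'e" where
  "lie_iter \<xi> js F = fold (\<lambda>j. local_lie (\<xi> j)) js F"

lemma local_form_lie_iter:
  assumes "local_form S k F" "\<And>j. smooth_on S (\<xi> j)"
  shows "local_form S k (lie_iter \<xi> js F)"
  using assms(1) by (induction js arbitrary: F) (simp_all add: lie_iter_def local_form_lie assms(2))

lemma lie_iter_zero: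
  assumes S: "open S" and \<xi>: "\<And>j. smooth_on S (\<xi> j)" and F: "\<And>x us. x \<in> S \<Longrightarrow> length us = k \<Longrightarrow> F x us = 0"
    and x: "x \<in> S" "length us = k"
  shows "lie_iter \<xi> js F x us = 0"
  using F
proof (induction js arbitrary: F)
  case (Cons j js)
  have "local_lie (\<xi> j) F x us = 0" if "x \<in> S" "length us = k" for x us
  proof -
    have "local_lie (\<xi> j) F x us = local_lie (\<xi> j) (\<lambda>x us. 0) x us"
      by (rule local_lie_cong[OF S that]) (simp_all add: Cons.prems)
    then show ?thesis using local_lie_zero[OF \<xi> that(1)] by simp
  qed
  then have "lie_iter \<xi> js (local_lie (\<xi> j) F) x us = 0" by (rule Cons.IH)
  then show ?case by (simp add: lie_iter_def)
qed (simp add: lie_iter_def x)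

text \<open>
  An index 0 stands for a Lie derivative along $\xi_0 = 0$, and whatever is applied afterwards
  preserves zero.
\<close>

lemma lie_iter_vanishes:
  assumes F: "local_form S k F" and \<xi>: "\<And>j. smooth_on S (\<xi> j)" and \<xi>0: "\<And>x. x \<in> S \<Longrightarrow> \<xi> 0 x = 0"
    and x: "x \<in> S" "length us = k" and js: "0 \<in> set js"
  shows "lie_iter \<xi> js F x us = 0"
proof -
  obtain as bs where js: "js = as @ 0 # bs" using js by (meson split_list)
  have S: "open S" by (rule local_formD(1)[OF F])
  let ?G = "lie_iter \<xi> as F"
  have "local_lie (\<xi> 0) ?G x us = 0" if "x \<in> S" "length us = k" for x us
  proof -
    have "local_lie (\<xi> 0) ?G x us = local_lie (\<lambda>x. 0) ?G x us"
      by (rule local_lie_cong[OF S that]) (simp_all add: \<xi>0)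
    then show ?thesis using local_lie_zero_field[OF local_form_lie_iter[OF F \<xi>] that] by simp
  qed
  then have "lie_iter \<xi> bs (local_lie (\<xi> 0) ?G) x us = 0" by (rule lie_iter_zero[OF S \<xi> _ x])
  then show ?thesis by (simp add: js lie_iter_def)
qed

abbreviation compositions :: "nat \<Rightarrow> nat \<Rightarrow> nat list set" where
  "compositions n m \<equiv> {js. length js = n \<and> sum_list js = m}"

lemma finite_compositions: "finite (compositions n m)"
proof (rule finite_subset)
  show "compositions n m \<subseteq> {js. set js \<subseteq> {..m} \<and> length js = n}" using member_le_sum_list by auto
qed (simp add: finite_lists_length_eq)

lemma zero_in_composition:
  assumes "js \<in> compositions n m" "m < n" shows "0 \<in> set js"
proof -
  have "0 \<notin> set js \<Longrightarrow> length js \<le> sum_list js" for js :: "nat list"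
    by (induction js) auto
  then show ?thesis using assms by force
qed

text \<open>
  The last entry is split off because a further application of \<open>lie_series\<close> adds an outermost
  Lie derivative.
\<close>

lemma sum_compositions_snoc:
  "(\<Sum>i\<le>m. \<Sum>js\<in>compositions n (m - i). f (js @ [i])) = (\<Sum>js\<in>compositions (Suc n) m. f js)"
proof -
  have "(\<Sum>i\<le>m. \<Sum>js\<in>compositions n (m - i). f (js @ [i]))
     = (\<Sum>(i, js)\<in>(SIGMA i:{..m}. compositions n (m - i)). f (js @ [i]))"
    by (rule sum.Sigma) (simp_all add: finite_compositions)
  also have "\<dots> = (\<Sum>js\<in>compositions (Suc n) m. f js)"
  proof (rule sum.reindex_bij_witness[where i = "\<lambda>js. (last js, butlast js)" and j = "\<lambda>(i, js). js @ [i]"])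
    fix js assume "js \<in> compositions (Suc n) m"
    then have js: "js = butlast js @ [last js]" "length (butlast js) = n" "sum_list js = m"
      by (auto intro: append_butlast_last_id[symmetric])
    have "sum_list (butlast js) + last js = m"
      using js(1,3) by (metis sum_list.Cons sum_list.Nil sum_list_append add.right_neutral)
    then show "(last js, butlast js) \<in> (SIGMA i:{..m}. compositions n (m - i))" using js(2) by auto
    show "(case (last js, butlast js) of (i, js) \<Rightarrow> js @ [i]) = js" using js(1) by simp
  qed auto
  finally show ?thesis .
qed

lemma loc_lie_series_power:
  fixes N :: "('b, 'e::euclidean_space) chart set"
  assumes d: "d \<in> charts N" and K: "local_form (chart_image d) k (loc N K d)"
    and X: "\<And>i. smooth_on (chart_image d) (\<lambda>x. loc N (X i) d x [])"
    and x: "x \<in> chart_image d" and us: "length us = k"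
  shows "loc N ((lie_series N X ^^ n) (const_series K) m) d x us
    = (\<Sum>js\<in>compositions n m. lie_iter (\<lambda>i x. loc N (X i) d x []) js (loc N K d) x us)"
  using x us
proof (induction n arbitrary: m x us)
  case 0
  have "compositions 0 m = (if m = 0 then {[]} else {})" by auto
  then show ?case by (simp add: loc_def const_series_def lie_iter_def)
next
  case (Suc n)
  let ?T = "\<lambda>m. (lie_series N X ^^ n) (const_series K) m"
  let ?\<xi> = "\<lambda>i x. loc N (X i) d x []"
  let ?F = "\<lambda>js. lie_iter ?\<xi> js (loc N K d)"
  have S: "open (chart_image d)" by (rule chartsD(3)[OF d])
  have F: "local_form (chart_image d) k (?F js)" for js by (rule local_form_lie_iter[OF K X])
  have T: "local_form (chart_image d) k (loc N (?T m) d)" for m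
    by (rule local_form_cong[OF local_form_sum[OF S F]]) (use Suc.IH in simp)
  have "loc N ((lie_series N X ^^ Suc n) (const_series K) m) d x us
      = (\<Sum>i\<le>m. loc N (lie_deriv N (X i) (?T (m - i))) d x us)"
    by (simp add: lie_series_def loc_def)
  also have "\<dots> = (\<Sum>i\<le>m. \<Sum>js\<in>compositions n (m - i). ?F (js @ [i]) x us)"
  proof (rule sum.cong[OF refl])
    fix i
    have "loc N (lie_deriv N (X i) (?T (m - i))) d x us = local_lie (?\<xi> i) (loc N (?T (m - i)) d) x us"
      by (rule loc_lie_deriv[OF d T Suc.prems])
    also have "\<dots> = local_lie (?\<xi> i) (\<lambda>x us. \<Sum>js\<in>compositions n (m - i). ?F js x us) x us"
      by (rule local_lie_cong[OF S Suc.prems Suc.IH]) auto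
    also have "\<dots> = (\<Sum>js\<in>compositions n (m - i). local_lie (?\<xi> i) (?F js) x us)"
      by (rule local_lie_sum[OF S F X Suc.prems])
    finally show "loc N (lie_deriv N (X i) (?T (m - i))) d x us = (\<Sum>js\<in>compositions n (m - i). ?F (js @ [i]) x us)"
      by (simp add: lie_iter_def)
  qed
  also have "\<dots> = (\<Sum>js\<in>compositions (Suc n) m. ?F js x us)"
    by (rule sum_compositions_snoc)
  finally show ?case .
qed

text \<open>
  Each bracket contributes a sign.  The induction replaces the form by its
  Lie derivative and collects the signs in the factor \<open>r\<close>.
\<close>

lemma loc_iterated_bracket:
  assumes d: "d \<in> charts (natlas A B L)"
    and X: "\<And>i. smooth_on (chart_image d) (\<lambda>x. loc (natlas A B L) (jL A B L (a i)) d x [])"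
    and F: "local_form (chart_image d) k F"
    and K: "\<And>x us. x \<in> chart_image d \<Longrightarrow> length us = k \<Longrightarrow> loc (natlas A B L) K d x us = r *\<^sub>R F x us"
    and x: "x \<in> chart_image d" and us: "length us = k"
  shows "loc (natlas A B L) (iterated_bracket A B L (map (\<lambda>j. (0, a j)) js) k K) d x us
    = ((-1) ^ length js * r) *\<^sub>R lie_iter (\<lambda>i x. loc (natlas A B L) (jL A B L (a i)) d x []) js F x us"
  using F K
proof (induction js arbitrary: F K r)
  case Nil
  then show ?case by (simp add: lie_iter_def x us)
next
  case (Cons j js)
  let ?N = "natlas A B L"
  let ?\<xi> = "\<lambda>x. loc ?N (jL A B L (a j)) d x []"
  let ?K = "fn_bracket ?N k 0 K (jL A B L (a j))"
  have S: "open (chart_image d)" by (rule chartsD(3)[OF d])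
  have rF: "local_form (chart_image d) k (\<lambda>x us. r *\<^sub>R F x us)"
    using local_form_scale_add[OF Cons.prems(1) local_form_zero[OF S], of r] by simp
  have K: "local_form (chart_image d) k (loc ?N K d)"
    by (rule local_form_cong[OF rF]) (simp add: Cons.prems(2))
  have "loc ?N ?K d x us = (- r) *\<^sub>R local_lie ?\<xi> F x us" if xus: "x \<in> chart_image d" "length us = k" for x us
  proof -
    have "loc ?N ?K d x us = - local_lie ?\<xi> (loc ?N K d) x us"
      by (rule loc_fn_bracket[OF d K X xus])
    also have "local_lie ?\<xi> (loc ?N K d) x us = local_lie ?\<xi> (\<lambda>x us. r *\<^sub>R F x us) x us"
      by (rule local_lie_cong[OF S xus]) (simp_all add: Cons.prems(2))
    also have "\<dots> = r *\<^sub>R local_lie ?\<xi> F x us"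
      using local_lie_scale_add[where r = r, OF Cons.prems(1) local_form_zero[OF S] X xus] local_lie_zero[OF X xus(1)] by simp
    finally show ?thesis by simp
  qed
  from Cons.IH[OF local_form_lie[OF Cons.prems(1) X] this] show ?case
    by (simp add: lie_iter_def)
qed

text \<open>
  For sections of $NL$ the exponent is $n(n-1)/2 + n(n+1)/2 = 2\cdot n(n-1)/2 + n$.
\<close>

lemma star_sign_degree_zero: "(-1) ^ star_sign (replicate n 0) = ((-1) ^ n :: real)"
proof -
  have "(\<Sum>i<n. (n - 1 - i) * (replicate n 0 ! i + 1)) = (\<Sum>i<n. n - Suc i)"
    by (rule sum.cong) auto
  also have "\<dots> = (\<Sum>i<n. i)" by (rule sum.nat_diff_reindex)
  finally have "star_sign (replicate n 0) = (\<Sum>i<n. i) + n * (n + 1) div 2"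
    by (simp add: star_sign_def)
  also have "n * (n + 1) div 2 = (\<Sum>i<n. i) + n"
    using gauss_sum_nat[of n] by (simp add: atMost_atLeast0[symmetric] lessThan_Suc_atMost[symmetric])
  finally have "star_sign (replicate n 0) = 2 * (\<Sum>i<n. i) + n" by simp
  then show ?thesis by (simp add: power_add power_mult)
qed

section \<open>Maurer-Cartan series and exponential series\<close>

context slice_submanifold
begin

lemma smooth_on_loc_jL_neg_series:
  assumes "s i \<in> nforms A B L 0" and c: "c \<in> S"
  shows "smooth_on (chart_image (nc c)) (\<lambda>x. loc N (jL A B L (neg_series s i)) (nc c) x [])"
proof (rule smooth_on_cong)
  show "smooth_on (chart_image (nc c)) (\<lambda>x. - loc N (jL A B L (s i)) (nc c) x [])"
    by (rule smooth_on_minus[OF smooth_on_loc_jL[OF c assms(1)]])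
qed (simp add: loc_jL[OF c], simp add: loc_def neg_series_def)

text \<open>
  The equality is checked in one component, for a slice chart \<open>c\<close>, where all terms are
  normal parts of iterated local Lie derivatives.  Both series have the same terms from order 1 on
  and are finite in each power of $\varepsilon$; finiteness is also what lets the
  projection to the normal part pass through the sum over \<open>n\<close>.
\<close>

lemma MC_eq_PL_exp:
  assumes K: "\<And>c. c \<in> S \<Longrightarrow> local_form (chart_image (nc c)) k (loc N K (nc c))"
    and K0: "\<And>p vs. p \<in> L \<Longrightarrow> length vs = k \<Longrightarrow> set vs \<subseteq> tsub A B L p \<Longrightarrow> PL A B L K p vs = (\<lambda>_. 0)"
    and s: "formal_deformation A B L s"
    and p: "p \<in> L" and vs: "length vs = k" "set vs \<subseteq> tsub A B L p"
  shows "MC A B L k K (neg_series s) m p vs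
    = PL A B L (exp_lie_series N (\<lambda>i. jL A B L (neg_series s i)) (const_series K) m) p vs"
proof
  fix c
  let ?X = "\<lambda>i. jL A B L (neg_series s i)"
  let ?q = "zero_section p"
  let ?ws = "map (dzero A B L p) vs"
  show "MC A B L k K (neg_series s) m p vs c = PL A B L (exp_lie_series N ?X (const_series K) m) p vs c"
  proof (cases "c \<in> slice_charts_at A B L p")
    case False
    then show ?thesis by (simp add: MC_def lbracket_series_def lbracket_def PL_def normal_component_def)
  next
    case c: True
    then have cS: "c \<in> S" "p \<in> fst c" by (auto simp: slice_charts_at)
    let ?d = "nc c"
    let ?\<xi> = "\<lambda>i x. loc N (?X i) ?d x []"
    define x where "x = snd ?d ?q"
    define us where "us = map (\<lambda>w. w ?d) ?ws"
    define F where "F = loc N K ?d"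
    define T where "T n = (\<Sum>js\<in>compositions n m. lie_iter ?\<xi> js F x us)" for n
    have d: "?d \<in> charts N" by (rule nc_charts[OF cS(1)])
    have dq: "?d \<in> charts_at N ?q" by (rule zero_section_charts_at[OF p c])
    have ws: "set ?ws \<subseteq> tspace N ?q" using vs(2) dzero_tspace[OF p] by auto
    have x: "x \<in> chart_image ?d" using dq by (simp add: x_def charts_at_iff chart_image_def)
    have us: "length us = k" using vs(1) by (simp add: us_def)
    have F: "local_form (chart_image ?d) k F" unfolding F_def by (rule K[OF cS(1)])
    have \<xi>: "smooth_on (chart_image ?d) (?\<xi> i)" for i
      using s by (intro smooth_on_loc_jL_neg_series[OF _ cS(1)]) (simp add: formal_deformation_def)
    \<comment> \<open>The coefficient \<open>s 0\<close> vanishes on \<open>L\<close>, which contains the base points of $NL$.\<close>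
    have \<xi>0: "?\<xi> 0 y = 0" if y: "y \<in> chart_image ?d" for y
    proof -
      have "chart_inv c (tpart B y) \<in> L"
        using slice_inv(1)[OF cS(1)] y chart_image_nc[OF cS(1)] by blast
      then have "s 0 (chart_inv c (tpart B y)) [] = (\<lambda>_. 0)"
        using s by (simp add: formal_deformation_def nform_zero_def)
      then show ?thesis unfolding loc_jL[OF cS(1) y] by (simp add: loc_def neg_series_def)
    qed
    \<comment> \<open>From here on, all forms are evaluated through their coordinate expressions at \<open>x\<close> and \<open>us\<close>.\<close>
    have at_q: "G ?q ?ws ?d = loc N G ?d x us" for G
      unfolding x_def us_def by (rule loc_at_point[OF smooth_atlas_natlas dq ws])
    have PLc: "PL A B L G p vs c = npart B (loc N G ?d x us)" for G
      using c at_q[of G] by (simp add: PL_def normal_component_def)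
    have T0: "T n = 0" if "m < n" for n
      unfolding T_def using lie_iter_vanishes[where \<xi> = ?\<xi>, OF F \<xi> \<xi>0 x us] zero_in_composition[OF _ that]
      by (intro sum.neutral) blast
    define f where "f n = (1 / fact n) *\<^sub>R npart B (T n)" for n
    have f_sum: "f sums (\<Sum>n\<le>m. f n)"
      by (rule sums_finite) (auto simp: f_def T0 linear_0[OF linear_npart])
    have "(\<lambda>n. (1 / fact n) *\<^sub>R T n) sums (\<Sum>n\<le>m. (1 / fact n) *\<^sub>R T n)"
      by (rule sums_finite) (auto simp: T0)
    moreover have "exp_lie_series N ?X (const_series K) m ?q ?ws ?d = (\<Sum>n. (1 / fact n) *\<^sub>R T n)"
      unfolding exp_lie_series_def at_q loc_lie_series_power[OF d F[unfolded F_def] \<xi> x us] T_def F_def ..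
    ultimately have "PL A B L (exp_lie_series N ?X (const_series K) m) p vs c = npart B (\<Sum>n\<le>m. (1 / fact n) *\<^sub>R T n)"
      using c by (simp add: PL_def normal_component_def sums_iff)
    then have E: "PL A B L (exp_lie_series N ?X (const_series K) m) p vs c = suminf f"
      using f_sum by (simp add: f_def linear_sum[OF linear_npart] linear_scale[OF linear_npart] sums_iff)
    have "lbracket_series A B L k K (replicate n (0, neg_series s)) m p vs c = npart B (T n)" for n
    proof -
      have "lbracket A B L k K (map2 (\<lambda>a j. (fst a, snd a j)) (replicate n (0, neg_series s)) js) p vs c
          = npart B (lie_iter ?\<xi> js F x us)" if js: "js \<in> compositions n m" for js
      proof -
        have 1: "map2 (\<lambda>a j. (fst a, snd a j)) (replicate n (0, neg_series s)) js = map (\<lambda>j. (0, neg_series s j)) js"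
          using js by (intro nth_equalityI) auto
        have 2: "map fst (map (\<lambda>j. (0, neg_series s j)) js) = replicate n 0"
          using js by (intro nth_equalityI) auto
        have "loc N (iterated_bracket A B L (map (\<lambda>j. (0, neg_series s j)) js) k K) ?d x us
            = ((-1) ^ length js * 1) *\<^sub>R lie_iter ?\<xi> js F x us"
          by (rule loc_iterated_bracket[OF d \<xi> F _ x us]) (simp add: F_def)
        then have "lbracket A B L k K (map (\<lambda>j. (0, neg_series s j)) js) p vs c
          = ((-1) ^ n * (-1) ^ n) *\<^sub>R npart B (lie_iter ?\<xi> js F x us)"
          using js unfolding lbracket_def 2 star_sign_degree_zero PLc
          by (simp add: linear_scale[OF linear_npart])
        also have "((-1) ^ n * (-1) ^ n :: real) = 1" by (simp add: power_mult_distrib[symmetric])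
        finally show ?thesis unfolding 1 by simp
      qed
      then show ?thesis by (simp add: lbracket_series_def T_def linear_sum[OF linear_npart])
    qed
    then have "MC A B L k K (neg_series s) m p vs c = (\<Sum>n. f (Suc n))"
      unfolding MC_def f_def by (simp only:)
    also have "\<dots> = suminf f - f 0" by (rule suminf_split_head[OF sums_summable[OF f_sum]])
    \<comment> \<open>The sum defining \<open>MC\<close> starts at order 1; the missing term is \<open>PL A B L K\<close>.\<close>
    also have "f 0 = 0"
    proof (cases "m = 0")
      case True
      then have "compositions 0 m = {[]}" by auto
      then have "f 0 = npart B (loc N K ?d x us)" by (simp add: f_def T_def lie_iter_def F_def)
      also have "\<dots> = 0" using K0[OF p vs] PLc[of K] by simp
      finally show ?thesis .
    next
      case False
      then have "compositions 0 m = {}" by auto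
      then have "T 0 = 0" unfolding T_def by (simp only: sum.empty)
      then show ?thesis by (simp add: f_def linear_0[OF linear_npart])
    qed
    finally show ?thesis using E by simp
  qed
qed

end

text \<open>
  Charts contained in the open set are charts of the maximal atlas of the ambient manifold, and
  cover the image.
\<close>

lemma diffeo_onto_open_of_diffeomorphism:
  assumes N: "smooth_atlas N" and A: "smooth_atlas A" and f: "diffeomorphism N (open_submanifold A U) f"
  shows "diffeo_onto_open N A f (inv_into (points N) f)"
proof
  let ?g = "inv_into (points N) f"
  let ?A = "open_submanifold A U"
  have bij: "bij_betw f (points N) (points ?A)" and sf: "smooth_map N ?A f" and sg: "smooth_map ?A N ?g"
    using f by (auto simp: diffeomorphism_def)
  show "?g (f q) = q" if "q \<in> points N" for q using bij that by (simp add: bij_betw_def)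
  fix d q assume d: "d \<in> charts N" and q: "q \<in> points N"
  have "f q \<in> points ?A" using bij q by (rule bij_betwE[rule_format])
  then obtain e where e: "e \<in> ?A" "f q \<in> fst e" by (auto simp: points_def)
  have eA: "e \<in> charts A" using e by (simp add: open_submanifold_def)
  have eA': "e \<in> charts ?A"
    using e chartsD(1)[OF eA] charts_compatible[OF A eA]
    by (auto simp: charts_def points_def open_submanifold_def)
  have "smooth_rep d e f" "smooth_rep e d ?g"
    using sf sg d eA' by (simp_all add: smooth_map_def smooth_rep_def)
  moreover have "f (?g y) = y" if "y \<in> fst e" for y
    using bij that e(1) by (auto simp: bij_betw_def points_def intro!: f_inv_into_f)
  ultimately show "\<exists>e\<in>charts A. f q \<in> fst e \<and> smooth_rep d e f \<and> smooth_rep e d ?g \<and> (\<forall>y\<in>fst e. f (?g y) = y)"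
    using eA e(2) by blast
qed (fact N A)+

theorem proposition5p3:
  fixes A :: "('m::{t2_space, second_countable_topology}, 'e::euclidean_space) chart set"
    and B :: "'e set" and L :: "'m set"
    and \<Psi> :: "('m, 'e) form" and l :: nat
    and \<tau> :: "'m \<times> ('m, 'e) tvec \<Rightarrow> 'm"
    and s :: "nat \<Rightarrow> ('m, 'e) form"
  assumes "smooth_manifold A"
    and "l \<ge> 1" and "\<Psi> \<in> tforms A (2 * l - 1)" and "square_zero A (2 * l - 1) \<Psi>"
    and "B \<subseteq> Basis" and "compact L" and "psi_submanifold A B L (2 * l - 1) \<Psi>"
    and "tubular_neighborhood A B L \<tau>"
    and "formal_deformation A B L s"
  shows "formal_psi_deformation A B L (2 * l - 1) (pullback (natlas A B L) A \<tau> \<Psi>) s \<longleftrightarrow>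
    (\<forall>m. nform_zero A B L (2 * l - 1)
       (MC A B L (2 * l - 1) (pullback (natlas A B L) A \<tau> \<Psi>) (neg_series s) m))"
proof -
  have A: "smooth_atlas A" using assms(1) by (simp add: smooth_manifold_def)
  interpret slice_submanifold A B L
    using A assms(5,7) by unfold_locales (simp_all add: psi_submanifold_def)
  obtain g where g: "diffeo_onto_open N A \<tau> g"
    using assms(8) diffeo_onto_open_of_diffeomorphism[OF smooth_atlas_natlas A]
    unfolding tubular_neighborhood_def by blast
  have \<tau>0: "\<And>p. p \<in> L \<Longrightarrow> \<tau> (zero_section p) = p" using assms(8) by (simp add: tubular_neighborhood_def)
  let ?k = "2 * l - 1"
  let ?\<Psi> = "pullback N A \<tau> \<Psi>"
  have "MC A B L ?k ?\<Psi> (neg_series s) m p vs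
      = PL A B L (exp_lie_series N (\<lambda>i. jL A B L (neg_series s i)) (const_series ?\<Psi>) m) p vs"
    if "p \<in> L" "length vs = ?k" "set vs \<subseteq> tsub A B L p" for p vs m
    using that assms(9) nc_charts
    by (intro MC_eq_PL_exp diffeo_onto_open.local_form_pullback[OF g assms(3)] PL_pullback_zero[OF g \<tau>0 assms(7)])
  then show ?thesis using assms(9) by (auto simp: formal_psi_deformation_def nform_zero_def)
qed

end
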